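(* Let $K$ be a field, let $Q$ be a finite quiver, and let $Sk(Q)$ be the skeleton of $KQ$. Let $V$ be the vertex set of $Sk(Q)$. Viewing $V$ as a partially ordered set, the incidence algebra $Incid(V)$ is isomorphic (as a $K$-algebra) to $Sk(Q)$.
   Context: Paths in a quiver include the paths of length zero (the vertices) and are composed from left to right: a path $p$ from $v$ to $w$ satisfies $vp=p=pw$ in the path algebra. Two paths are parallel if they have the same start vertex and the same end vertex. For a finite quiver $\Gamma$, the commuting algebra of $K\Gamma$ (or of $\Gamma$) is $K\Gamma/C$, where $C$ is the two-sided ideal of $K\Gamma$ generated by all differences $p-q$ of parallel paths $p,q$ (of any lengths $\ge 0$). For the given quiver $Q$ let $\rho\colon KQ\to KQ/C$ be the canonical surjection onto its commuting algebra. On the vertex set of $Q$ define $v\sim w$ if there are paths from $v$ to $w$ and from $w$ to $v$; the equivalence classes $D_1,\dots,D_m$ are the path connected components of $Q$. Choose a vertex $w_i\in D_i$ for each $i$. The skeleton of $KQ$ is $Sk(Q)=\mathrm{End}_{KQ/C}(P)$, where $P=\bigoplus_{i=1}^m\rho(w_i)KQ/C$ as a right $KQ/C$-module (endomorphisms composed as functions). The vertex set of $Sk(Q)$ is $V=\{x_1,\dots,x_m\}$, with $x_i$ corresponding to $D_i$, partially ordered by $x_i\le x_j$ if and only if there is a path in $Q$ from $w_i$ to $w_j$. For a finite partially ordered set $(S,\preceq)$, $t$ is an immediate successor of $s$ if $s\prec t$ and there is no $u\in S$ with $s\prec u\prec t$. The incidence algebra $Incid(S)$ is the commuting algebra of the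 quiver $Q(S)$ whose vertex set is $S$ and which has an arrow from $s$ to $t$ if $t$ is an immediate successor of $s$. *)

theory Defs
  imports "Graph_Theory.Arc_Walk" "HOL-Algebra.Module" "HOL-Algebra.QuotRing"
begin

text \<open>
  A finite quiver is a \<open>fin_digraph\<close>: loops and multiple arcs are allowed, and so is the quiver
  without vertices. \<open>K\<close>-algebras are carried by the record type \<open>module\<close> of HOL-Algebra, which
  has both a ring structure and a scalar multiplication (the locale \<open>algebra\<close> is not used,
  because it asks for commutativity).
\<close>

section \<open>Paths\<close>

text \<open>
  A path is a triple of its start vertex, its list of arcs and its end vertex. The paths of
  length zero are the triples \<open>(v, [], v)\<close>.
\<close>

type_synonym ('v, 'e) qpath = "'v \<times> 'e list \<times> 'v"

definition paths :: "('v, 'e) pre_digraph \<Rightarrow> ('v, 'e) qpath set" where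
  "paths Q = {(u, p, v). pre_digraph.awalk Q u p v}"

fun path_start :: "('v, 'e) qpath \<Rightarrow> 'v" where
  "path_start (u, p, v) = u"

fun path_end :: "('v, 'e) qpath \<Rightarrow> 'v" where
  "path_end (u, p, v) = v"

text \<open>Composition is from left to right; it is only used if \<open>path_end x = path_start y\<close>.\<close>

fun path_comp :: "('v, 'e) qpath \<Rightarrow> ('v, 'e) qpath \<Rightarrow> ('v, 'e) qpath" where
  "path_comp (u, p, v) (v', q, w) = (u, p @ q, w)"

definition vertex_path :: "'v \<Rightarrow> ('v, 'e) qpath" where
  "vertex_path v = (v, [], v)"

definition parallel_paths ::
    "('v, 'e) pre_digraph \<Rightarrow> ('v, 'e) qpath \<Rightarrow> ('v, 'e) qpath \<Rightarrow> bool" where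
  "parallel_paths Q x y \<longleftrightarrow>
     x \<in> paths Q \<and> y \<in> paths Q \<and> path_start x = path_start y \<and> path_end x = path_end y"

section \<open>The path algebra and the commuting algebra\<close>

text \<open>
  Elements of the path algebra are the finitely supported functions from paths to \<open>K\<close>, extended
  by zero to all triples. The coefficient of \<open>f g\<close> at \<open>x\<close> is the sum of \<open>f y \<cdot> g z\<close> over the
  finitely many factorizations \<open>x = y z\<close>.
\<close>

definition path_algebra ::
    "('k, 'c) ring_scheme \<Rightarrow> ('v, 'e) pre_digraph \<Rightarrow> ('k, ('v, 'e) qpath \<Rightarrow> 'k) module" where
  "path_algebra K Q =
     \<lparr>carrier = {f. (\<forall>x\<in>paths Q. f x \<in> carrier K) \<and> (\<forall>x. x \<notin> paths Q \<longrightarrow> f x = \<zero>\<^bsub>K\<^esub>) \<and>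
                    finite {x. f x \<noteq> \<zero>\<^bsub>K\<^esub>}},
      mult = (\<lambda>f g x. finsum K (\<lambda>(y, z). f y \<otimes>\<^bsub>K\<^esub> g z)
                {(y, z). y \<in> paths Q \<and> z \<in> paths Q \<and>
                   path_end y = path_start z \<and> path_comp y z = x}),
      one = (\<lambda>x. if x \<in> vertex_path ` verts Q then \<one>\<^bsub>K\<^esub> else \<zero>\<^bsub>K\<^esub>),
      zero = (\<lambda>x. \<zero>\<^bsub>K\<^esub>),
      add = (\<lambda>f g x. f x \<oplus>\<^bsub>K\<^esub> g x),
      smult = (\<lambda>c f x. c \<otimes>\<^bsub>K\<^esub> f x)\<rparr>"

definition path_elt ::
    "('k, 'c) ring_scheme \<Rightarrow> ('v, 'e) qpath \<Rightarrow> ('v, 'e) qpath \<Rightarrow> 'k" where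
  "path_elt K x = (\<lambda>y. if y = x then \<one>\<^bsub>K\<^esub> else \<zero>\<^bsub>K\<^esub>)"

definition commuting_ideal ::
    "('k, 'c) ring_scheme \<Rightarrow> ('v, 'e) pre_digraph \<Rightarrow> (('v, 'e) qpath \<Rightarrow> 'k) set" where
  "commuting_ideal K Q =
     Idl\<^bsub>path_algebra K Q\<^esub>
       {path_elt K x \<ominus>\<^bsub>path_algebra K Q\<^esub> path_elt K y |x y. parallel_paths Q x y}"

text \<open>
  \<open>Quot\<close> only yields a ring. The scalar multiplication on cosets is added in the style of
  \<open>rcoset_mult\<close>.
\<close>

definition quotient_algebra ::
    "('k, 'a, 'm) module_scheme \<Rightarrow> 'a set \<Rightarrow> ('k, 'a set) module" where
  "quotient_algebra A I =
     \<lparr>carrier = carrier (A Quot I), mult = mult (A Quot I), one = one (A Quot I),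
      zero = zero (A Quot I), add = add (A Quot I),
      smult = (\<lambda>c X. \<Union>x\<in>X. I +>\<^bsub>A\<^esub> (c \<odot>\<^bsub>A\<^esub> x))\<rparr>"

definition commuting_algebra ::
    "('k, 'c) ring_scheme \<Rightarrow> ('v, 'e) pre_digraph \<Rightarrow> ('k, (('v, 'e) qpath \<Rightarrow> 'k) set) module" where
  "commuting_algebra K Q = quotient_algebra (path_algebra K Q) (commuting_ideal K Q)"

definition commuting_proj ::
    "('k, 'c) ring_scheme \<Rightarrow> ('v, 'e) pre_digraph \<Rightarrow>
     (('v, 'e) qpath \<Rightarrow> 'k) \<Rightarrow> (('v, 'e) qpath \<Rightarrow> 'k) set" where
  "commuting_proj K Q f = commuting_ideal K Q +>\<^bsub>path_algebra K Q\<^esub> f"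

section \<open>Right modules and their endomorphism algebras\<close>

text \<open>
  As for the record \<open>module\<close>, only the additive part of the underlying ring record is
  meaningful; \<open>mult\<close> and \<open>one\<close> are left undefined.
\<close>

record ('a, 'm) right_module = "'m ring" +
  ract :: "'m \<Rightarrow> 'a \<Rightarrow> 'm"

definition principal_right_ideal :: "('a, 'c) ring_scheme \<Rightarrow> 'a \<Rightarrow> ('a, 'a) right_module" where
  "principal_right_ideal A e =
     \<lparr>carrier = {e \<otimes>\<^bsub>A\<^esub> a |a. a \<in> carrier A}, mult = undefined, one = undefined,
      zero = \<zero>\<^bsub>A\<^esub>, add = add A, ract = mult A\<rparr>"

definition direct_sum ::
    "'i set \<Rightarrow> ('i \<Rightarrow> ('a, 'm) right_module) \<Rightarrow> ('a, 'i \<Rightarrow> 'm) right_module" where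
  "direct_sum I M =
     \<lparr>carrier = {x \<in> \<Pi>\<^sub>E i\<in>I. carrier (M i). finite {i \<in> I. x i \<noteq> \<zero>\<^bsub>M i\<^esub>}},
      mult = undefined, one = undefined,
      zero = (\<lambda>i\<in>I. \<zero>\<^bsub>M i\<^esub>),
      add = (\<lambda>x y. \<lambda>i\<in>I. x i \<oplus>\<^bsub>M i\<^esub> y i),
      ract = (\<lambda>x a. \<lambda>i\<in>I. ract (M i) (x i) a)\<rparr>"

text \<open>
  The endomorphisms of a right module \<open>M\<close> over a \<open>K\<close>-algebra \<open>A\<close>, composed as functions. The
  field acts on \<open>M\<close>, and hence on its endomorphisms, through \<open>c \<mapsto> c \<cdot> 1\<close> in \<open>A\<close>.
\<close>

definition End_algebra ::
    "('k, 'a, 'c) module_scheme \<Rightarrow> ('a, 'm) right_module \<Rightarrow> ('k, 'm \<Rightarrow> 'm) module" where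
  "End_algebra A M =
     \<lparr>carrier = {\<phi> \<in> carrier M \<rightarrow>\<^sub>E carrier M.
         (\<forall>x\<in>carrier M. \<forall>y\<in>carrier M. \<phi> (x \<oplus>\<^bsub>M\<^esub> y) = \<phi> x \<oplus>\<^bsub>M\<^esub> \<phi> y) \<and>
         (\<forall>x\<in>carrier M. \<forall>a\<in>carrier A. \<phi> (ract M x a) = ract M (\<phi> x) a)},
      mult = compose (carrier M),
      one = (\<lambda>x\<in>carrier M. x),
      zero = (\<lambda>x\<in>carrier M. \<zero>\<^bsub>M\<^esub>),
      add = (\<lambda>\<phi> \<psi>. \<lambda>x\<in>carrier M. \<phi> x \<oplus>\<^bsub>M\<^esub> \<psi> x),
      smult = (\<lambda>c \<phi>. \<lambda>x\<in>carrier M. ract M (\<phi> x) (c \<odot>\<^bsub>A\<^esub> \<one>\<^bsub>A\<^esub>))\<rparr>"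

section \<open>The skeleton\<close>

definition path_equiv :: "('v, 'e) pre_digraph \<Rightarrow> ('v \<times> 'v) set" where
  "path_equiv Q = {(v, w). v \<in> verts Q \<and> w \<in> verts Q \<and>
     (\<exists>p. pre_digraph.awalk Q v p w) \<and> (\<exists>p. pre_digraph.awalk Q w p v)}"

definition path_components :: "('v, 'e) pre_digraph \<Rightarrow> 'v set set" where
  "path_components Q = verts Q // path_equiv Q"

text \<open>
  Instead of being numbered from \<open>1\<close> to \<open>m\<close>, the components index themselves: \<open>w\<close> chooses a vertex
  \<open>w D\<close> in each component \<open>D\<close>, and \<open>D\<close> itself serves as the vertex of the skeleton that
  corresponds to \<open>D\<close>.
\<close>

definition skeleton ::
    "('k, 'c) ring_scheme \<Rightarrow> ('v, 'e) pre_digraph \<Rightarrow> ('v set \<Rightarrow> 'v) \<Rightarrow>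
     ('k, ('v set \<Rightarrow> (('v, 'e) qpath \<Rightarrow> 'k) set) \<Rightarrow> ('v set \<Rightarrow> (('v, 'e) qpath \<Rightarrow> 'k) set)) module"
  where
  "skeleton K Q w =
     End_algebra (commuting_algebra K Q)
       (direct_sum (path_components Q)
          (\<lambda>D. principal_right_ideal (commuting_algebra K Q)
                 (commuting_proj K Q (path_elt K (vertex_path (w D))))))"

definition skeleton_verts :: "('v, 'e) pre_digraph \<Rightarrow> 'v set set" where
  "skeleton_verts Q = path_components Q"

definition skeleton_order ::
    "('v, 'e) pre_digraph \<Rightarrow> ('v set \<Rightarrow> 'v) \<Rightarrow> ('v set \<times> 'v set) set" where
  "skeleton_order Q w =
     {(D, E). D \<in> skeleton_verts Q \<and> E \<in> skeleton_verts Q \<and>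
        (\<exists>p. pre_digraph.awalk Q (w D) p (w E))}"

lemma equiv_path_equiv:
  assumes "wf_digraph Q"
  shows "equiv (verts Q) (path_equiv Q)"
proof -
  interpret wf_digraph Q by fact
  show ?thesis
    unfolding path_equiv_def
    by (rule equivI)
      (auto simp: refl_on_def sym_def trans_def
        intro: awalk_appendI exI[where x = "[]"] awalk_Nil_iff[THEN iffD2])
qed

lemma partial_order_skeleton:
  assumes "wf_digraph Q" and w: "\<And>D. D \<in> path_components Q \<Longrightarrow> w D \<in> D"
  shows "partial_order_on (skeleton_verts Q) (skeleton_order Q w)"
proof -
  interpret wf_digraph Q by fact
  note eq = equiv_path_equiv[OF \<open>wf_digraph Q\<close>]
  have wv: "w D \<in> verts Q" if "D \<in> path_components Q" for D
    using w[OF that] that in_quotient_imp_subset[OF eq] unfolding path_components_def by blast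
  have "D = E" if "D \<in> path_components Q" "E \<in> path_components Q"
      "awalk (w D) p (w E)" "awalk (w E) q (w D)" for D E p q
  proof -
    have "(w D, w E) \<in> path_equiv Q"
      using that wv unfolding path_equiv_def by blast
    then show ?thesis
      using quotient_eqI[OF eq] that w unfolding path_components_def by blast
  qed
  moreover have "awalk (w D) [] (w D)" if "D \<in> path_components Q" for D
    using wv[OF that] by (simp add: awalk_Nil_iff)
  ultimately show ?thesis
    unfolding partial_order_on_def preorder_on_def refl_on_def trans_def antisym_def
      skeleton_order_def skeleton_verts_def
    by (blast intro: awalk_appendI)
qed

section \<open>Incidence algebras\<close>

text \<open>A finite partially ordered set is given by its set \<open>S\<close> of elements and its order \<open>r\<close>.\<close>

definition immediate_succ :: "'s set \<Rightarrow> ('s \<times> 's) set \<Rightarrow> 's \<Rightarrow> 's \<Rightarrow> bool" where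
  "immediate_succ S r s t \<longleftrightarrow>
     s \<in> S \<and> t \<in> S \<and> (s, t) \<in> r \<and> s \<noteq> t \<and>
     \<not> (\<exists>u\<in>S. ((s, u) \<in> r \<and> s \<noteq> u) \<and> ((u, t) \<in> r \<and> u \<noteq> t))"

definition poset_quiver :: "'s set \<Rightarrow> ('s \<times> 's) set \<Rightarrow> ('s, 's \<times> 's) pre_digraph" where
  "poset_quiver S r =
     \<lparr>verts = S, arcs = {(s, t). immediate_succ S r s t}, tail = fst, head = snd\<rparr>"

definition Incid ::
    "('k, 'c) ring_scheme \<Rightarrow> 's set \<Rightarrow> ('s \<times> 's) set \<Rightarrow>
     ('k, (('s, 's \<times> 's) qpath \<Rightarrow> 'k) set) module" where
  "Incid K S r = commuting_algebra K (poset_quiver S r)"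

section \<open>Isomorphisms of algebras\<close>

definition algebra_isomorphic ::
    "('k, 'c) ring_scheme \<Rightarrow> ('k, 'a, 'd) module_scheme \<Rightarrow> ('k, 'b, 'e) module_scheme \<Rightarrow> bool" where
  "algebra_isomorphic K A B \<longleftrightarrow>
     (\<exists>h\<in>ring_iso A B. \<forall>c\<in>carrier K. \<forall>x\<in>carrier A. h (c \<odot>\<^bsub>A\<^esub> x) = c \<odot>\<^bsub>B\<^esub> h x)"

end

theory Submission
  imports Defs
begin

text \<open>
  Both algebras are the algebra of matrices, indexed by the path connected components, whose entry at
  \<open>(D, E)\<close> is arbitrary if there is a path from \<open>w D\<close> to \<open>w E\<close> and zero otherwise.

  The bridge is a description of the commuting algebra of any finite quiver. Sending an element of
  the path algebra to the matrix of the sums of its coefficients over all paths from \<open>u\<close> to \<open>v\<close> is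
  multiplicative, and it identifies parallel paths. It loses nothing else: modulo the commuting ideal
  every path equals one chosen path with the same ends (\<open>equiv_spread_path_sum\<close>), so the kernel is
  exactly the commuting ideal. Hence the commuting algebra is the algebra of the
  matrices supported on the reachability relation (\<open>commuting_algebra_iso_matrices\<close>).

  In the quiver of a finite poset reachability is the order itself, because every relation refines
  to a chain of immediate successors (\<open>reach_poset_quiver\<close>). This gives the incidence algebra.

  For the skeleton, an endomorphism of the sum of the modules \<open>e\<^sub>D A\<close> is left multiplication by a
  matrix whose entry at \<open>(D, E)\<close> lies in \<open>e\<^sub>D A e\<^sub>E\<close>. When \<open>A\<close> is the commuting algebra and \<open>e\<^sub>D\<close> the
  class of the vertex \<open>w D\<close>, this corner is the place \<open>(w D, w E)\<close> of the matrix description: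
  a copy of \<open>K\<close> if there is a path from \<open>w D\<close> to \<open>w E\<close>, and zero if not (\<open>End_iso_matrices\<close>).
\<close>

section \<open>Finite sums\<close>

context abelian_monoid
begin

lemma finsum_Sigma:
  assumes "finite B" "\<And>b. b \<in> B \<Longrightarrow> finite (C b)"
    and "\<And>b c. b \<in> B \<Longrightarrow> c \<in> C b \<Longrightarrow> g b c \<in> carrier G"
  shows "(\<Oplus>b\<in>B. \<Oplus>c\<in>C b. g b c) = finsum G (\<lambda>(b, c). g b c) (Sigma B C)"
proof -
  have inner: "(\<Oplus>c\<in>C b. g b c) = finsum G (\<lambda>(b', c). g b' c) (Pair b ` C b)" if "b \<in> B" for b
    using that assms by (subst add.finprod_reindex) (auto simp: inj_on_def Pi_def)
  have "(\<Oplus>b\<in>B. \<Oplus>c\<in>C b. g b c) = (\<Oplus>b\<in>B. finsum G (\<lambda>(b', c). g b' c) (Pair b ` C b))"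
    using inner assms by (intro add.finprod_cong') (auto simp: Pi_def intro!: finsum_closed)
  also have "\<dots> = finsum G (\<lambda>(b, c). g b c) (\<Union>b\<in>B. Pair b ` C b)"
    using assms by (subst add.finprod_UN_disjoint) (auto simp: pairwise_def disjnt_def)
  also have "(\<Union>b\<in>B. Pair b ` C b) = Sigma B C" by auto
  finally show ?thesis .
qed

lemma finsum_bij:
  assumes "bij_betw k A B" "f \<in> B \<rightarrow> carrier G" "\<And>a. a \<in> A \<Longrightarrow> f (k a) = g a"
  shows "finsum G f B = finsum G g A"
proof -
  have B: "B = k ` A" and inj: "inj_on k A" using assms(1) by (auto simp: bij_betw_def)
  have "finsum G f B = (\<Oplus>a\<in>A. f (k a))"
    unfolding B using assms(2) inj by (subst add.finprod_reindex) (auto simp: B)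
  also have "\<dots> = finsum G g A"
    using assms B by (intro add.finprod_cong') (auto simp: Pi_def simp flip: assms(3))
  finally show ?thesis .
qed

lemma finsum_fibres:
  assumes "finite T" "finite B" "k ` T \<subseteq> B" "f \<in> T \<rightarrow> carrier G"
  shows "finsum G f T = (\<Oplus>b\<in>B. finsum G f {t \<in> T. k t = b})"
proof -
  have "(\<Oplus>b\<in>B. finsum G f {t \<in> T. k t = b}) = finsum G (\<lambda>(b, t). f t) (Sigma B (\<lambda>b. {t \<in> T. k t = b}))"
    using assms by (intro finsum_Sigma) auto
  also have "\<dots> = finsum G f T"
    using assms by (intro finsum_bij[where k = "\<lambda>t. (k t, t)"])
      (auto simp: bij_betw_def inj_on_def image_iff Pi_def)
  finally show ?thesis ..
qed

lemma finsum_only: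
  assumes "i \<in> A" "finite A" "f i \<in> carrier G" "\<And>j. j \<in> A \<Longrightarrow> j \<noteq> i \<Longrightarrow> f j = \<zero>"
  shows "finsum G f A = f i"
proof -
  have "finsum G f A = finsum G f {i}"
  proof (rule add.finprod_mono_neutral_cong_right)
    show "f \<in> A \<rightarrow> carrier G"
    proof
      fix j assume "j \<in> A"
      then show "f j \<in> carrier G" using assms by (cases "j = i") auto
    qed
  qed (use assms in auto)
  then show ?thesis using assms by simp
qed

end

lemma (in semiring) finsum_times_finsum:
  assumes "finite A" "finite B" "f \<in> A \<rightarrow> carrier R" "g \<in> B \<rightarrow> carrier R"
  shows "finsum R f A \<otimes> finsum R g B = finsum R (\<lambda>(a, b). f a \<otimes> g b) (A \<times> B)"
proof -
  have "finsum R f A \<otimes> finsum R g B = (\<Oplus>a\<in>A. \<Oplus>b\<in>B. f a \<otimes> g b)"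
    using assms by (subst finsum_ldistr) (auto intro!: add.finprod_cong' finsum_rdistr simp: Pi_def)
  also have "\<dots> = finsum R (\<lambda>(a, b). f a \<otimes> g b) (A \<times> B)"
    using assms by (intro finsum_Sigma) auto
  finally show ?thesis .
qed

section \<open>The path algebra is a ring\<close>

locale quiver_algebra = cring K + fin_digraph Q
  for K (structure) and Q :: "('v, 'e) pre_digraph"
begin

abbreviation PA where "PA \<equiv> path_algebra K Q"

definition factorizations ::
    "('v, 'e) qpath \<Rightarrow> (('v, 'e) qpath \<times> ('v, 'e) qpath) set" where
  "factorizations x = {(y, z). y \<in> paths Q \<and> z \<in> paths Q \<and>
     path_end y = path_start z \<and> path_comp y z = x}"

lemma path_comp_assoc: "path_comp (path_comp a b) c = path_comp a (path_comp b c)"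
  by (cases a; cases b; cases c) auto

lemma path_append: "(u, p, v) \<in> paths Q \<Longrightarrow> (v, q, w) \<in> paths Q \<Longrightarrow> (u, p @ q, w) \<in> paths Q"
  by (auto simp: paths_def intro: awalk_appendI simp del: awalk_append_iff)

lemma path_comp_in_paths:
  "y \<in> paths Q \<Longrightarrow> z \<in> paths Q \<Longrightarrow> path_end y = path_start z \<Longrightarrow> path_comp y z \<in> paths Q"
  by (cases y; cases z) (auto intro: path_append)

lemma path_comp_ends [simp]:
  "path_start (path_comp y z) = path_start y" "path_end (path_comp y z) = path_end z"
  by (cases y; cases z; simp)+

lemma path_ends_in_verts: "x \<in> paths Q \<Longrightarrow> path_start x \<in> verts Q \<and> path_end x \<in> verts Q"
  by (cases x) (auto simp: paths_def awalk_hd_in_verts awalk_last_in_verts)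

lemma vertex_path_simps [simp]:
  "path_start (vertex_path v) = v" "path_end (vertex_path v) = v"
  "path_comp (vertex_path (path_start x)) x = x" "path_comp x (vertex_path (path_end x)) = x"
  by (cases x; simp add: vertex_path_def)+

lemma vertex_path_in_paths: "v \<in> verts Q \<Longrightarrow> vertex_path v \<in> paths Q"
  by (auto simp: vertex_path_def paths_def awalk_Nil_iff)

lemma finite_factorizations: "finite (factorizations x)"
proof -
  obtain u p v where x: "x = (u, p, v)" by (cases x)
  have "factorizations x
    \<subseteq> (\<lambda>(n, m). ((u, take n p, m), (m, drop n p, v))) ` ({..length p} \<times> verts Q)"
  proof
    fix t assume t: "t \<in> factorizations x"
    then obtain q m r where "t = ((u, q, m), (m, r, v))" "p = q @ r"
      by (cases t; cases "fst t"; cases "snd t") (auto simp: factorizations_def x)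
    moreover from this have "m \<in> verts Q"
      using t path_ends_in_verts[of "(u, q, m)"] by (auto simp: factorizations_def)
    ultimately show "t \<in> (\<lambda>(n, m). ((u, take n p, m), (m, drop n p, v))) ` ({..length p} \<times> verts Q)"
      by (intro image_eqI[of _ _ "(length q, m)"]) auto
  qed
  then show ?thesis by (rule finite_subset) simp
qed

lemma PA_carrier: "f \<in> carrier PA \<longleftrightarrow>
    (\<forall>x. f x \<in> carrier K) \<and> (\<forall>x. x \<notin> paths Q \<longrightarrow> f x = \<zero>) \<and> finite {x. f x \<noteq> \<zero>}"
  unfolding path_algebra_def
  by (simp del: split_paired_All) (metis zero_closed)

lemma PA_off_paths: "f \<in> carrier PA \<Longrightarrow> x \<notin> paths Q \<Longrightarrow> f x = \<zero>"
  by (simp add: PA_carrier del: split_paired_All)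

lemma PA_coeff: "f \<in> carrier PA \<Longrightarrow> f x \<in> carrier K"
  by (simp add: PA_carrier del: split_paired_All)

lemma PA_simps [simp]:
  "zero PA = (\<lambda>x. \<zero>)"
  "add PA = (\<lambda>f g x. f x \<oplus> g x)"
  "smult PA = (\<lambda>c f x. c \<otimes> f x)"
  "one PA = (\<lambda>x. if x \<in> vertex_path ` verts Q then \<one> else \<zero>)"
  by (auto simp: path_algebra_def)

lemma PA_mult:
  "mult PA f g x = finsum K (\<lambda>(y, z). f y \<otimes> g z) (factorizations x)"
  by (simp add: path_algebra_def factorizations_def)

lemma PA_add_closed: "f \<in> carrier PA \<Longrightarrow> g \<in> carrier PA \<Longrightarrow> (\<lambda>x. f x \<oplus> g x) \<in> carrier PA"
  unfolding PA_carrier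
  by (auto intro: finite_subset[of _ "{x. f x \<noteq> \<zero>} \<union> {x. g x \<noteq> \<zero>}"])

lemma PA_smult_closed: "c \<in> carrier K \<Longrightarrow> f \<in> carrier PA \<Longrightarrow> (\<lambda>x. c \<otimes> f x) \<in> carrier PA"
  unfolding PA_carrier
  by (auto intro: finite_subset[of _ "{x. f x \<noteq> \<zero>}"])

lemma PA_one_closed: "one PA \<in> carrier PA"
proof -
  have "{x. one PA x \<noteq> \<zero>} \<subseteq> vertex_path ` verts Q" by auto
  then show ?thesis
    unfolding PA_carrier by (auto intro: finite_subset vertex_path_in_paths)
qed

lemma PA_mult_closed:
  assumes f: "f \<in> carrier PA" and g: "g \<in> carrier PA"
  shows "mult PA f g \<in> carrier PA"
proof -
  let ?F = "{x. f x \<noteq> \<zero>}" and ?G = "{x. g x \<noteq> \<zero>}"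
  have closed: "f x \<in> carrier K" "g x \<in> carrier K" for x
    using f g by (auto simp: PA_coeff)
  have zero: "mult PA f g x = \<zero>" if "x \<notin> paths Q \<or> x \<notin> case_prod path_comp ` (?F \<times> ?G)" for x
    unfolding PA_mult
  proof (rule add.finprod_one_eqI, clarify)
    fix y z assume yz: "(y, z) \<in> factorizations x"
    then have "f y = \<zero> \<or> g z = \<zero>"
      using that path_comp_in_paths by (fastforce simp: factorizations_def)
    then show "f y \<otimes> g z = \<zero>" using closed[of y] closed[of z] by auto
  qed
  have "{x. mult PA f g x \<noteq> \<zero>} \<subseteq> case_prod path_comp ` (?F \<times> ?G)"
    using zero by blast
  moreover have "finite (case_prod path_comp ` (?F \<times> ?G))"
    using f g by (auto simp: PA_carrier)
  moreover have "mult PA f g x \<in> carrier K" for x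
    unfolding PA_mult using closed by (auto intro!: finsum_closed)
  ultimately show ?thesis
    using zero unfolding PA_carrier by (auto intro: finite_subset)
qed

text \<open>
  Both sides sum \<open>f a \<cdot> g b \<cdot> h c\<close> over the triples with \<open>a b c = x\<close>: the left side meets such a
  triple as a factorization of \<open>x\<close> into \<open>(a b, c)\<close> and then of \<open>a b\<close>, the right side as one into
  \<open>(a, b c)\<close> and then of \<open>b c\<close>.
\<close>

lemma PA_mult_assoc:
  assumes f: "f \<in> carrier PA" and g: "g \<in> carrier PA" and h: "h \<in> carrier PA"
  shows "mult PA (mult PA f g) h = mult PA f (mult PA g h)"
proof
  fix x
  have [simp]: "f y \<in> carrier K" "g y \<in> carrier K" "h y \<in> carrier K" for y
    using f g h by (auto simp: PA_coeff)
  note fin = finite_factorizations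
  let ?L = "Sigma (factorizations x) (\<lambda>t. factorizations (fst t))"
  let ?R = "Sigma (factorizations x) (\<lambda>t. factorizations (snd t))"
  have "mult PA (mult PA f g) h x
      = (\<Oplus>t\<in>factorizations x. \<Oplus>s\<in>factorizations (fst t). f (fst s) \<otimes> g (snd s) \<otimes> h (snd t))"
    unfolding PA_mult using fin
    by (auto intro!: add.finprod_cong' simp: case_prod_unfold finsum_ldistr)
  also have "\<dots> = finsum K (\<lambda>(t, s). f (fst s) \<otimes> g (snd s) \<otimes> h (snd t)) (?L)"
    using fin by (intro finsum_Sigma) auto
  also have "\<dots> = finsum K (\<lambda>(t, s). f (fst t) \<otimes> (g (fst s) \<otimes> h (snd s))) (?R)"
  proof (rule sym, rule finsum_bij)
    let ?k = "\<lambda>((y, c), (a, b)). ((a, path_comp b c), (b, c))"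
    let ?k' = "\<lambda>((a, y), (b, c)). ((path_comp a b, c), (a, b))"
    show "bij_betw ?k ?L ?R"
      by (rule bij_betw_byWitness[where f' = ?k'])
        (auto simp: factorizations_def path_comp_assoc path_comp_in_paths intro: path_append)
  qed (auto simp: m_assoc)
  also have "\<dots> = (\<Oplus>t\<in>factorizations x. \<Oplus>s\<in>factorizations (snd t). f (fst t) \<otimes> (g (fst s) \<otimes> h (snd s)))"
    using fin by (intro finsum_Sigma[symmetric]) auto
  also have "\<dots> = mult PA f (mult PA g h) x"
    unfolding PA_mult using fin
    by (auto intro!: add.finprod_cong' simp: case_prod_unfold finsum_rdistr)
  finally show "mult PA (mult PA f g) h x = mult PA f (mult PA g h) x" .
qed

lemma PA_one_mult:
  assumes f: "f \<in> carrier PA"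
  shows "mult PA (one PA) f = f" "mult PA f (one PA) = f"
proof -
  have [simp]: "f y \<in> carrier K" for y using f by (auto simp: PA_coeff)
  have *: "mult PA (one PA) f x = f x \<and> mult PA f (one PA) x = f x" for x
  proof (cases "x \<in> paths Q")
    case False
    then have "factorizations x = {}"
      using path_comp_in_paths by (auto simp: factorizations_def)
    then show ?thesis using False f unfolding PA_mult by (simp add: PA_off_paths)
  next
    case True
    note v = path_ends_in_verts[OF True]
    have "mult PA (one PA) f x = (case (vertex_path (path_start x), x) of (y, z) \<Rightarrow> one PA y \<otimes> f z)"
      unfolding PA_mult
    proof (rule finsum_only)
      show "(vertex_path (path_start x), x) \<in> factorizations x"
        using True v by (auto simp: factorizations_def vertex_path_in_paths)
      fix t assume "t \<in> factorizations x" "t \<noteq> (vertex_path (path_start x), x)"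
      then have "fst t \<notin> vertex_path ` verts Q"
        by (cases t; cases "snd t") (auto simp: factorizations_def vertex_path_def)
      then show "(case t of (y, z) \<Rightarrow> one PA y \<otimes> f z) = \<zero>"
        by (auto split: prod.splits)
    qed (auto simp: finite_factorizations)
    moreover have "mult PA f (one PA) x = (case (x, vertex_path (path_end x)) of (y, z) \<Rightarrow> f y \<otimes> one PA z)"
      unfolding PA_mult
    proof (rule finsum_only)
      show "(x, vertex_path (path_end x)) \<in> factorizations x"
        using True v by (auto simp: factorizations_def vertex_path_in_paths)
      fix t assume "t \<in> factorizations x" "t \<noteq> (x, vertex_path (path_end x))"
      then have "snd t \<notin> vertex_path ` verts Q"
        by (cases t; cases "fst t") (auto simp: factorizations_def vertex_path_def)
      then show "(case t of (y, z) \<Rightarrow> f y \<otimes> one PA z) = \<zero>"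
        by (auto split: prod.splits)
    qed (auto simp: finite_factorizations)
    ultimately show ?thesis using v by auto
  qed
  then show "mult PA (one PA) f = f" "mult PA f (one PA) = f" by (auto simp del: PA_simps)
qed

lemma ring_path_algebra: "ring PA"
proof (rule ringI)
  show "abelian_group PA"
  proof (rule abelian_groupI)
    fix f assume f: "f \<in> carrier PA"
    then have "(\<lambda>x. (\<ominus> \<one>) \<otimes> f x) \<in> carrier PA" by (intro PA_smult_closed) auto
    moreover have "(\<lambda>x. (\<ominus> \<one>) \<otimes> f x) \<oplus>\<^bsub>PA\<^esub> f = \<zero>\<^bsub>PA\<^esub>"
      using f by (auto simp: PA_coeff l_minus l_neg)
    ultimately show "\<exists>g\<in>carrier PA. g \<oplus>\<^bsub>PA\<^esub> f = \<zero>\<^bsub>PA\<^esub>" by blast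
  next
    show "\<zero>\<^bsub>PA\<^esub> \<in> carrier PA" by (simp add: PA_carrier)
  qed (auto simp: a_assoc a_comm a_lcomm PA_coeff intro: PA_add_closed)
  show "monoid PA"
    by (rule monoidI) (auto simp: PA_mult_closed PA_one_closed PA_mult_assoc PA_one_mult simp del: PA_simps)
next
  fix f g h assume "f \<in> carrier PA" "g \<in> carrier PA" "h \<in> carrier PA"
  then have [simp]: "f y \<in> carrier K" "g y \<in> carrier K" "h y \<in> carrier K" for y
    by (auto simp: PA_coeff)
  show "(f \<oplus>\<^bsub>PA\<^esub> g) \<otimes>\<^bsub>PA\<^esub> h = f \<otimes>\<^bsub>PA\<^esub> h \<oplus>\<^bsub>PA\<^esub> g \<otimes>\<^bsub>PA\<^esub> h"
    by (auto simp: PA_mult case_prod_unfold l_distr finsum_addf intro!: ext)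
  show "h \<otimes>\<^bsub>PA\<^esub> (f \<oplus>\<^bsub>PA\<^esub> g) = h \<otimes>\<^bsub>PA\<^esub> f \<oplus>\<^bsub>PA\<^esub> h \<otimes>\<^bsub>PA\<^esub> g"
    by (auto simp: PA_mult case_prod_unfold r_distr finsum_addf intro!: ext)
qed

end

section \<open>The commuting algebra as an algebra of matrices\<close>

text \<open>
  For a preorder \<open>r\<close> on \<open>S\<close> this is the structural matrix algebra: the square matrices indexed by \<open>S\<close>
  whose entries vanish outside \<open>r\<close>. For a partial order it is the classical incidence algebra in
  its matrix form.
\<close>

definition structural_matrices ::
    "('k, 'c) ring_scheme \<Rightarrow> 's set \<Rightarrow> ('s \<times> 's) set \<Rightarrow> ('k, 's \<Rightarrow> 's \<Rightarrow> 'k) module" where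
  "structural_matrices K S r =
     \<lparr>carrier = {m. (\<forall>u v. m u v \<in> carrier K) \<and> (\<forall>u v. (u, v) \<notin> r \<longrightarrow> m u v = \<zero>\<^bsub>K\<^esub>)},
      mult = (\<lambda>m n u v. \<Oplus>\<^bsub>K\<^esub>s\<in>S. m u s \<otimes>\<^bsub>K\<^esub> n s v),
      one = (\<lambda>u v. if u = v \<and> u \<in> S then \<one>\<^bsub>K\<^esub> else \<zero>\<^bsub>K\<^esub>),
      zero = (\<lambda>u v. \<zero>\<^bsub>K\<^esub>),
      add = (\<lambda>m n u v. m u v \<oplus>\<^bsub>K\<^esub> n u v),
      smult = (\<lambda>c m u v. c \<otimes>\<^bsub>K\<^esub> m u v)\<rparr>"

definition reach :: "('v, 'e) pre_digraph \<Rightarrow> ('v \<times> 'v) set" where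
  "reach Q = {(u, v). \<exists>p. pre_digraph.awalk Q u p v}"

lemma structural_matrices_simps [simp]:
  "carrier (structural_matrices K S r) =
     {m. (\<forall>u v. m u v \<in> carrier K) \<and> (\<forall>u v. (u, v) \<notin> r \<longrightarrow> m u v = \<zero>\<^bsub>K\<^esub>)}"
  "mult (structural_matrices K S r) = (\<lambda>m n u v. \<Oplus>\<^bsub>K\<^esub>s\<in>S. m u s \<otimes>\<^bsub>K\<^esub> n s v)"
  "one (structural_matrices K S r) = (\<lambda>u v. if u = v \<and> u \<in> S then \<one>\<^bsub>K\<^esub> else \<zero>\<^bsub>K\<^esub>)"
  "zero (structural_matrices K S r) = (\<lambda>u v. \<zero>\<^bsub>K\<^esub>)"
  "add (structural_matrices K S r) = (\<lambda>m n u v. m u v \<oplus>\<^bsub>K\<^esub> n u v)"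
  "smult (structural_matrices K S r) = (\<lambda>c m u v. c \<otimes>\<^bsub>K\<^esub> m u v)"
  by (simp_all add: structural_matrices_def)

context quiver_algebra
begin

abbreviation Mat where "Mat \<equiv> structural_matrices K (verts Q) (reach Q)"
abbreviation CI where "CI \<equiv> commuting_ideal K Q"

text \<open>
  This map is the concrete form of the canonical surjection \<open>\<rho>\<close>: modulo the differences of parallel
  paths, all that remains of an element of the path algebra is, for each pair of vertices, the sum
  of its coefficients along the paths between them. Restricting the sum to the support keeps
  it finite although a quiver with oriented cycles has infinitely many paths.
\<close>

definition path_sum :: "(('v, 'e) qpath \<Rightarrow> 'a) \<Rightarrow> 'v \<Rightarrow> 'v \<Rightarrow> 'a" where
  "path_sum f u v = finsum K f {x. f x \<noteq> \<zero> \<and> path_start x = u \<and> path_end x = v}"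

lemma path_sum_eq:
  assumes "f \<in> carrier PA" "finite X" "{x. f x \<noteq> \<zero>} \<subseteq> X"
  shows "path_sum f u v = finsum K f {x \<in> X. path_start x = u \<and> path_end x = v}"
  unfolding path_sum_def
  by (rule add.finprod_mono_neutral_cong_left) (use assms in \<open>auto simp: PA_coeff\<close>)

lemma path_sum_closed: "f \<in> carrier PA \<Longrightarrow> path_sum f \<in> carrier Mat"
proof -
  assume f: "f \<in> carrier PA"
  have "path_sum f u v = \<zero>" if "(u, v) \<notin> reach Q" for u v
  proof -
    have "{x. f x \<noteq> \<zero> \<and> path_start x = u \<and> path_end x = v} = {}"
      using that PA_off_paths[OF f] by (fastforce simp: paths_def reach_def)
    then show ?thesis by (simp only: path_sum_def finsum_empty)
  qed
  moreover have "path_sum f u v \<in> carrier K" for u v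
    unfolding path_sum_def using f by (auto intro!: finsum_closed simp: PA_coeff)
  ultimately show ?thesis by auto
qed

lemma path_sum_add:
  assumes f: "f \<in> carrier PA" and g: "g \<in> carrier PA"
  shows "path_sum (\<lambda>x. f x \<oplus> g x) = (\<lambda>u v. path_sum f u v \<oplus> path_sum g u v)"
proof (intro ext)
  fix u v
  let ?X = "{x. f x \<noteq> \<zero>} \<union> {x. g x \<noteq> \<zero>}"
  have X: "finite ?X" using f g by (auto simp: PA_carrier)
  have "path_sum (\<lambda>x. f x \<oplus> g x) u v
      = finsum K (\<lambda>x. f x \<oplus> g x) {x \<in> ?X. path_start x = u \<and> path_end x = v}"
    using PA_add_closed[OF f g] X by (rule path_sum_eq) auto
  also have "\<dots> = path_sum f u v \<oplus> path_sum g u v"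
    using f g X by (simp add: path_sum_eq[OF f X] path_sum_eq[OF g X] finsum_addf PA_coeff del: Un_iff)
  finally show "path_sum (\<lambda>x. f x \<oplus> g x) u v = path_sum f u v \<oplus> path_sum g u v" .
qed

lemma path_sum_smult:
  assumes c: "c \<in> carrier K" and f: "f \<in> carrier PA"
  shows "path_sum (\<lambda>x. c \<otimes> f x) = (\<lambda>u v. c \<otimes> path_sum f u v)"
proof (intro ext)
  fix u v
  let ?X = "{x. f x \<noteq> \<zero>}"
  have X: "finite ?X" using f by (auto simp: PA_carrier)
  have "path_sum (\<lambda>x. c \<otimes> f x) u v
      = finsum K (\<lambda>x. c \<otimes> f x) {x \<in> ?X. path_start x = u \<and> path_end x = v}"
    using PA_smult_closed[OF c f] X by (rule path_sum_eq) (use c in auto)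
  also have "\<dots> = c \<otimes> path_sum f u v"
    unfolding path_sum_eq[OF f X order_refl]
    using f X c by (intro finsum_rdistr[symmetric]) (auto simp: PA_coeff)
  finally show "path_sum (\<lambda>x. c \<otimes> f x) u v = c \<otimes> path_sum f u v" .
qed

text \<open>
  Composable pairs of paths from \<open>u\<close> to \<open>v\<close> can be grouped by their product, which gives the sum of
  coefficients of the product, or by the vertex at which they meet, which gives the matrix product.
\<close>

lemma path_sum_mult:
  assumes f: "f \<in> carrier PA" and g: "g \<in> carrier PA"
  shows "path_sum (f \<otimes>\<^bsub>PA\<^esub> g) = path_sum f \<otimes>\<^bsub>Mat\<^esub> path_sum g"
proof (intro ext)
  fix u v
  have [simp]: "f y \<in> carrier K" "g y \<in> carrier K" for y
    using f g by (auto simp: PA_coeff)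
  let ?F = "{x. f x \<noteq> \<zero>}" and ?G = "{x. g x \<noteq> \<zero>}"
  let ?X = "case_prod path_comp ` (?F \<times> ?G)"
  let ?fg = "\<lambda>(y, z). f y \<otimes> g z"
  let ?T = "{(y, z) \<in> ?F \<times> ?G. path_end y = path_start z \<and> path_start y = u \<and> path_end z = v}"
  have F: "finite ?F" and G: "finite ?G" using f g by (auto simp: PA_carrier)
  have FG: "?F \<subseteq> paths Q" "?G \<subseteq> paths Q" using f g PA_off_paths by blast+
  have T: "finite ?T" using F G by (auto intro: finite_subset[of _ "?F \<times> ?G"])
  have fac: "mult PA f g x = finsum K ?fg {(y, z) \<in> ?F \<times> ?G. path_end y = path_start z \<and> path_comp y z = x}" for x
    unfolding PA_mult
  proof (rule add.finprod_mono_neutral_cong_right)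
    show "{(y, z) \<in> ?F \<times> ?G. path_end y = path_start z \<and> path_comp y z = x} \<subseteq> factorizations x"
      using FG by (auto simp: factorizations_def simp del: split_paired_All)
    fix t assume t: "t \<in> factorizations x - {(y, z) \<in> ?F \<times> ?G. path_end y = path_start z \<and> path_comp y z = x}"
    obtain y z where yz: "t = (y, z)" by (cases t)
    then have "f y = \<zero> \<or> g z = \<zero>" using t by (auto simp: factorizations_def)
    moreover have "f y \<in> carrier K" "g z \<in> carrier K" by simp_all
    ultimately show "?fg t = \<zero>" unfolding yz by auto
  qed (auto simp: finite_factorizations)
  have zero: "mult PA f g x = \<zero>" if "x \<notin> ?X" for x
  proof -
    have "path_comp y z \<noteq> x" if "f y \<noteq> \<zero>" "g z \<noteq> \<zero>" for y z
      using \<open>x \<notin> ?X\<close> image_eqI[of x "case_prod path_comp" "(y, z)" "?F \<times> ?G"] that by auto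
    then have "{(y, z) \<in> ?F \<times> ?G. path_end y = path_start z \<and> path_comp y z = x} = {}"
      by blast
    then show ?thesis unfolding fac by (simp only: finsum_empty)
  qed
  have "?T \<subseteq> ?F \<times> ?G" by auto
  then have sub: "case_prod path_comp ` ?T \<subseteq> ?X" by (rule image_mono)
  have ends: "path_start x = u \<and> path_end x = v" if "x \<in> case_prod path_comp ` ?T" for x
    using that by auto
  have im: "case_prod path_comp ` ?T \<subseteq> {x \<in> ?X. path_start x = u \<and> path_end x = v}"
  proof
    fix x assume x: "x \<in> case_prod path_comp ` ?T"
    show "x \<in> {x \<in> ?X. path_start x = u \<and> path_end x = v}"
      by (rule CollectI) (rule conjI[OF subsetD[OF sub x] ends[OF x]])
  qed
  have "path_sum (mult PA f g) u v
      = finsum K (mult PA f g) {x \<in> ?X. path_start x = u \<and> path_end x = v}"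
    using PA_mult_closed[OF f g] F G zero by (intro path_sum_eq finite_imageI finite_cartesian_product subsetI)
      (auto simp del: split_paired_All)
  also have "\<dots> = (\<Oplus>x\<in>{x \<in> ?X. path_start x = u \<and> path_end x = v}.
      finsum K ?fg {t \<in> ?T. case_prod path_comp t = x})"
    unfolding fac
    by (intro add.finprod_cong' refl arg_cong[where f = "finsum K ?fg"]) (auto intro!: finsum_closed)
  also have "\<dots> = finsum K ?fg ?T"
    using F G T im by (intro finsum_fibres[symmetric]) (auto simp: Pi_def)
  also have "\<dots> = (\<Oplus>s\<in>verts Q. finsum K ?fg {t \<in> ?T. path_end (fst t) = s})"
    using T FG path_ends_in_verts by (intro finsum_fibres) (auto simp: image_iff)
  also have "\<dots> = (\<Oplus>s\<in>verts Q. path_sum f u s \<otimes> path_sum g s v)"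
  proof (rule add.finprod_cong')
    fix s assume "s \<in> verts Q"
    have eq: "{t \<in> ?T. path_end (fst t) = s} =
        {y \<in> ?F. path_start y = u \<and> path_end y = s} \<times> {z \<in> ?G. path_start z = s \<and> path_end z = v}"
      by auto
    show "finsum K ?fg {t \<in> ?T. path_end (fst t) = s} = path_sum f u s \<otimes> path_sum g s v"
      unfolding eq path_sum_eq[OF f F order_refl] path_sum_eq[OF g G order_refl]
      using F G by (intro finsum_times_finsum[symmetric]) auto
  qed (use path_sum_closed f g in auto)
  finally show "path_sum (mult PA f g) u v = (path_sum f \<otimes>\<^bsub>Mat\<^esub> path_sum g) u v" by simp
qed

lemma path_sum_path_elt:
  assumes c: "c \<in> carrier K" and x: "x \<in> paths Q"
  shows "path_sum (\<lambda>y. if y = x then c else \<zero>)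
    = (\<lambda>u v. if u = path_start x \<and> v = path_end x then c else \<zero>)"
proof (intro ext)
  fix u v
  have cl: "(\<lambda>y. if y = x then c else \<zero>) \<in> carrier PA" using c x by (auto simp: PA_carrier)
  have "{y \<in> {x}. path_start y = u \<and> path_end y = v}
      = (if u = path_start x \<and> v = path_end x then {x} else {})" by auto
  moreover have "{y. (if y = x then c else \<zero>) \<noteq> \<zero>} \<subseteq> {x}" by auto
  note path_sum_eq[OF cl _ this]
  ultimately show "path_sum (\<lambda>y. if y = x then c else \<zero>) u v
      = (if u = path_start x \<and> v = path_end x then c else \<zero>)"
    using c by (simp del: split_paired_All)
qed

lemma path_sum_one: "path_sum (one PA) = one Mat"
proof (intro ext)
  fix u v
  have X: "{x \<in> vertex_path ` verts Q. path_start x = u \<and> path_end x = v}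
      = (if u = v \<and> u \<in> verts Q then {vertex_path u} else {})"
    by (auto simp: image_iff simp del: split_paired_All split_paired_Ex)
  have "{x. one PA x \<noteq> \<zero>} \<subseteq> vertex_path ` verts Q" by auto
  from path_sum_eq[OF PA_one_closed _ this, of u v, unfolded X]
  show "path_sum (one PA) u v = one Mat u v" by auto
qed

lemma path_elt_closed: "x \<in> paths Q \<Longrightarrow> path_elt K x \<in> carrier PA"
  by (auto simp: PA_carrier path_elt_def)

definition some_path :: "'v \<Rightarrow> 'v \<Rightarrow> ('v, 'e) qpath" where
  "some_path u v = (SOME x. x \<in> paths Q \<and> path_start x = u \<and> path_end x = v)"

lemma some_path:
  assumes "(u, v) \<in> reach Q"
  shows "some_path u v \<in> paths Q \<and> path_start (some_path u v) = u \<and> path_end (some_path u v) = v"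
proof -
  from assms obtain p where "(u, p, v) \<in> paths Q" by (auto simp: reach_def paths_def)
  then have "\<exists>x. x \<in> paths Q \<and> path_start x = u \<and> path_end x = v"
    by (intro exI[of _ "(u, p, v)"]) simp
  then show ?thesis unfolding some_path_def by (rule someI_ex)
qed

lemma path_reach: "x \<in> paths Q \<Longrightarrow> (path_start x, path_end x) \<in> reach Q"
  by (cases x) (auto simp: reach_def paths_def)

text \<open>
  A linear section of \<open>path_sum\<close>: each matrix entry is placed on one chosen path.
\<close>

definition spread :: "('v \<Rightarrow> 'v \<Rightarrow> 'a) \<Rightarrow> ('v, 'e) qpath \<Rightarrow> 'a" where
  "spread m x = (if x \<in> paths Q \<and> x = some_path (path_start x) (path_end x)
     then m (path_start x) (path_end x) else \<zero>)"

lemma spread_closed: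
  assumes "m \<in> carrier Mat"
  shows "spread m \<in> carrier PA"
proof -
  have "{x. spread m x \<noteq> \<zero>} \<subseteq> (\<lambda>(u, v). some_path u v) ` (verts Q \<times> verts Q)"
  proof
    fix x assume "x \<in> {x. spread m x \<noteq> \<zero>}"
    then have "x \<in> paths Q" "x = some_path (path_start x) (path_end x)"
      by (auto simp: spread_def split: if_splits)
    then show "x \<in> (\<lambda>(u, v). some_path u v) ` (verts Q \<times> verts Q)"
      using path_ends_in_verts by (intro image_eqI[of _ _ "(path_start x, path_end x)"]) auto
  qed
  then have "finite {x. spread m x \<noteq> \<zero>}" by (rule finite_subset) simp
  moreover have "spread m x \<in> carrier K" "x \<notin> paths Q \<Longrightarrow> spread m x = \<zero>" for x
    using assms by (auto simp: spread_def)
  ultimately show ?thesis unfolding PA_carrier by blast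
qed

lemma path_sum_spread:
  assumes m: "m \<in> carrier Mat"
  shows "path_sum (spread m) = m"
proof (intro ext)
  fix u v
  show "path_sum (spread m) u v = m u v"
  proof (cases "(u, v) \<in> reach Q")
    case False
    then show ?thesis using path_sum_closed[OF spread_closed[OF m]] m by simp
  next
    case True
    note p = some_path[OF True]
    have "path_sum (spread m) u v = finsum K (spread m) {some_path u v}"
      unfolding path_sum_def
      by (rule add.finprod_mono_neutral_cong_left)
        (use p m in \<open>auto simp: spread_def split: if_splits\<close>)
    also have "\<dots> = m u v" using p m by (auto simp: spread_def)
    finally show ?thesis .
  qed
qed

sublocale PA: ring PA by (rule ring_path_algebra)

lemma PA_minus_coeff:
  assumes "f \<in> carrier PA" "g \<in> carrier PA"
  shows "(f \<ominus>\<^bsub>PA\<^esub> g) x = f x \<ominus> g x"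
proof -
  have "(\<lambda>x. (\<ominus> \<one>) \<otimes> g x) \<in> carrier PA" using assms by (intro PA_smult_closed) auto
  moreover have "(\<lambda>x. (\<ominus> \<one>) \<otimes> g x) \<oplus>\<^bsub>PA\<^esub> g = \<zero>\<^bsub>PA\<^esub>"
    using assms by (auto simp: PA_coeff l_minus l_neg)
  ultimately have "\<ominus>\<^bsub>PA\<^esub> g = (\<lambda>x. (\<ominus> \<one>) \<otimes> g x)"
    using assms PA.minus_equality by metis
  then show ?thesis using assms by (simp add: a_minus_def PA_coeff l_minus)
qed

text \<open>
  A scalar multiple is a product in the path algebra, so ideals are closed under scalars.
\<close>

lemma PA_smult_mult:
  assumes "c \<in> carrier K" "f \<in> carrier PA"
  shows "(\<lambda>x. c \<otimes> f x) = (\<lambda>x. c \<otimes> one PA x) \<otimes>\<^bsub>PA\<^esub> f"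
proof
  fix x
  have "mult PA (\<lambda>x. c \<otimes> one PA x) f x = (\<Oplus>t\<in>factorizations x. c \<otimes> (case t of (y, z) \<Rightarrow> one PA y \<otimes> f z))"
    unfolding PA_mult using assms PA_coeff PA_one_closed
    by (intro add.finprod_cong') (auto simp: PA_coeff m_assoc)
  also have "\<dots> = c \<otimes> mult PA (one PA) f x"
    unfolding PA_mult using assms PA_coeff[OF PA_one_closed]
    by (intro finsum_rdistr[symmetric]) (auto simp: PA_coeff finite_factorizations)
  finally show "c \<otimes> f x = mult PA (\<lambda>x. c \<otimes> one PA x) f x"
    using PA_one_mult[OF assms(2)] by simp
qed

text \<open>
  The ring axioms for matrices are inherited from the path algebra through the surjection.
\<close>

lemma ring_Mat: "ring Mat"
proof -
  have hom: "path_sum \<in> ring_hom PA Mat"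
    by (rule ring_hom_memI)
      (simp_all only: path_sum_mult path_sum_add path_sum_one path_sum_closed PA_simps(2)
        structural_matrices_simps(5))
  have zero: "path_sum (zero PA) = zero Mat"
    by (intro ext) (simp add: path_sum_def)
  have "path_sum ` carrier PA = carrier Mat"
    using path_sum_closed path_sum_spread spread_closed by (blast intro: image_eqI[OF sym])
  then have "Mat\<lparr>carrier := path_sum ` carrier PA, zero := path_sum (zero PA)\<rparr> = Mat"
    unfolding zero by (simp del: structural_matrices_simps)
  then show ?thesis using PA.ring_hom_imp_img_ring[OF hom] by simp
qed

sublocale path_sum: ring_hom_ring PA Mat path_sum
  by (rule ring_hom_ringI[OF ring_path_algebra ring_Mat])
    (simp_all only: path_sum_mult path_sum_add path_sum_one path_sum_closed PA_simps(2)
      structural_matrices_simps(5))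

section \<open>The kernel and the commuting ideal\<close>

lemma generators_subset:
  "{path_elt K x \<ominus>\<^bsub>PA\<^esub> path_elt K y |x y. parallel_paths Q x y} \<subseteq> carrier PA"
  by (auto simp: parallel_paths_def intro!: PA.minus_closed path_elt_closed simp del: split_paired_All split_paired_Ex)

lemma ideal_CI: "ideal CI PA"
  unfolding commuting_ideal_def by (rule PA.genideal_ideal[OF generators_subset])

lemma CI_smult:
  assumes "c \<in> carrier K" "f \<in> CI"
  shows "(\<lambda>x. c \<otimes> f x) \<in> CI"
proof -
  interpret CI: ideal CI PA by (rule ideal_CI)
  have "(\<lambda>x. c \<otimes> one PA x) \<in> carrier PA"
    using assms(1) PA_one_closed by (rule PA_smult_closed)
  then show ?thesis
    using PA_smult_mult[of c f] assms CI.I_l_closed by (simp add: CI.Icarr)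
qed

lemma path_sum_elt: "x \<in> paths Q \<Longrightarrow> path_sum (path_elt K x) =
    (\<lambda>u v. if u = path_start x \<and> v = path_end x then \<one> else \<zero>)"
  unfolding path_elt_def by (rule path_sum_path_elt) simp_all

lemma CI_subset_kernel: "CI \<subseteq> a_kernel PA Mat path_sum"
  unfolding commuting_ideal_def
proof (rule PA.genideal_minimal)
  show "ideal (a_kernel PA Mat path_sum) PA" by (rule path_sum.kernel_is_ideal)
  have "path_elt K x \<ominus>\<^bsub>PA\<^esub> path_elt K y \<in> a_kernel PA Mat path_sum"
    if "parallel_paths Q x y" for x y
  proof -
    have xy: "x \<in> paths Q" "y \<in> paths Q" "path_sum (path_elt K x) = path_sum (path_elt K y)"
      using that by (auto simp: parallel_paths_def path_sum_elt simp del: split_paired_All)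
    have "path_sum (path_elt K x \<ominus>\<^bsub>PA\<^esub> path_elt K y) = zero Mat"
      using xy path_elt_closed path_sum_closed path_sum.S.r_neg
      by (simp add: a_minus_def path_sum.hom_add path_sum.hom_a_inv del: PA_simps structural_matrices_simps)
    then show ?thesis
      using xy path_elt_closed unfolding a_kernel_def' by blast
  qed
  then show "{path_elt K x \<ominus>\<^bsub>PA\<^esub> path_elt K y |x y. parallel_paths Q x y}
      \<subseteq> a_kernel PA Mat path_sum" by blast
qed

text \<open>
  Modulo the commuting ideal each path in the support of \<open>f\<close> may be replaced by the chosen path parallel to
  it, one path at a time; what results is the section applied to \<open>path_sum f\<close>. For \<open>f\<close> in the kernel
  of \<open>path_sum\<close> this leaves only an element of the ideal.
\<close>

lemma equiv_spread_path_sum: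
  assumes "finite F" "f \<in> carrier PA" "{x. f x \<noteq> \<zero>} \<subseteq> F"
  shows "\<exists>g\<in>CI. f = g \<oplus>\<^bsub>PA\<^esub> spread (path_sum f)"
  using assms
proof (induction F arbitrary: f)
  case empty
  interpret CI: ideal CI PA by (rule ideal_CI)
  have f: "f = zero PA" using empty by auto
  then have "path_sum f = zero Mat" by (simp add: path_sum.hom_zero del: PA_simps structural_matrices_simps)
  then have "spread (path_sum f) = zero PA" by (auto simp: spread_def)
  then show ?case using f CI.zero_closed by (intro bexI[of _ "zero PA"]) auto
next
  case (insert x F)
  interpret CI: ideal CI PA by (rule ideal_CI)
  show ?case
  proof (cases "x \<in> paths Q")
    case False
    then have "f x = \<zero>" using PA_off_paths insert.prems(1) by blast
    then show ?thesis using insert.prems by (intro insert.IH) auto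
  next
    case True
    define c where "c = f x"
    define y where "y = some_path (path_start x) (path_end x)"
    define f' where "f' = f(x := \<zero>)"
    define cx where "cx = (\<lambda>z. if z = x then c else \<zero>)"
    define cy where "cy = (\<lambda>z. if z = y then c else \<zero>)"
    have y: "y \<in> paths Q" "path_start y = path_start x" "path_end y = path_end x"
      using some_path[OF path_reach[OF True]] by (auto simp: y_def)
    have c: "c \<in> carrier K" using insert.prems PA_coeff by (simp add: c_def)
    have f'_cl: "f' \<in> carrier PA"
    proof -
      have "finite {z. f' z \<noteq> \<zero>}"
        by (rule finite_subset[of _ "{z. f z \<noteq> \<zero>}"])
          (use insert.prems in \<open>auto simp: f'_def PA_carrier\<close>)
      then show ?thesis
        unfolding PA_carrier using PA_coeff[OF insert.prems(1)] PA_off_paths[OF insert.prems(1)]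
        by (simp add: f'_def del: split_paired_All)
    qed
    have cx_cl: "cx \<in> carrier PA" and cy_cl: "cy \<in> carrier PA"
      using c True y by (auto simp: PA_carrier cx_def cy_def)
    have f: "f = (\<lambda>z. f' z \<oplus> cx z)"
      using c insert.prems by (auto simp: f'_def cx_def c_def PA_coeff)
    have "{z. f' z \<noteq> \<zero>} \<subseteq> F" using insert.prems by (auto simp: f'_def)
    then obtain g where g: "g \<in> CI" "f' = g \<oplus>\<^bsub>PA\<^esub> spread (path_sum f')"
      using insert.IH[OF f'_cl] by blast
    define d where "d = (\<lambda>z. c \<otimes> (path_elt K x \<ominus>\<^bsub>PA\<^esub> path_elt K y) z)"
    have "parallel_paths Q x y" using True y by (simp add: parallel_paths_def)
    then have "path_elt K x \<ominus>\<^bsub>PA\<^esub> path_elt K y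
        \<in> {path_elt K x \<ominus>\<^bsub>PA\<^esub> path_elt K y |x y. parallel_paths Q x y}" by blast
    then have "path_elt K x \<ominus>\<^bsub>PA\<^esub> path_elt K y \<in> CI"
      unfolding commuting_ideal_def by (rule subsetD[OF PA.genideal_self[OF generators_subset]])
    then have d: "d \<in> CI" unfolding d_def by (rule CI_smult[OF c])
    have d_eq: "d z = cx z \<ominus> cy z" for z
    proof -
      have "d z = c \<otimes> (path_elt K x z \<ominus> path_elt K y z)"
        unfolding d_def by (simp only: PA_minus_coeff[OF path_elt_closed[OF True] path_elt_closed[OF y(1)]])
      then show ?thesis
        using c by (auto simp: path_elt_def cx_def cy_def a_minus_def r_minus r_neg)
    qed
    have spread_cx: "spread (path_sum cx) = cy"
      unfolding cx_def path_sum_path_elt[OF c True]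
      using y by (intro ext) (auto simp: spread_def cy_def y_def[symmetric])
    have ps: "path_sum f = (\<lambda>u v. path_sum f' u v \<oplus> path_sum cx u v)"
      by (subst f) (rule path_sum_add[OF f'_cl cx_cl])
    have spread_f: "spread (path_sum f) = (\<lambda>z. spread (path_sum f') z \<oplus> cy z)"
      unfolding ps spread_cx[symmetric] by (intro ext) (simp add: spread_def)
    \<comment> \<open>trading the path \<open>x\<close> for \<open>y\<close>: the difference goes to the ideal, the rest to the section\<close>
    have exchange: "(p \<oplus> q) \<oplus> s = (p \<oplus> (s \<ominus> t)) \<oplus> (q \<oplus> t)"
      if "p \<in> carrier K" "q \<in> carrier K" "s \<in> carrier K" "t \<in> carrier K" for p q s t
      using that by algebra
    have "f = (\<lambda>z. (g z \<oplus> d z) \<oplus> spread (path_sum f) z)"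
    proof
      fix z
      have [simp]: "g z \<in> carrier K" "cx z \<in> carrier K" "cy z \<in> carrier K"
          "spread (path_sum f') z \<in> carrier K"
        using CI.Icarr[OF g(1)] cx_cl cy_cl spread_closed[OF path_sum_closed[OF f'_cl]]
        by (simp_all add: PA_coeff)
      have "f z = (g z \<oplus> spread (path_sum f') z) \<oplus> cx z"
        by (subst f, subst g(2)) simp
      also have "\<dots> = (g z \<oplus> d z) \<oplus> spread (path_sum f) z"
        unfolding d_eq spread_f by (rule exchange) simp_all
      finally show "f z = (g z \<oplus> d z) \<oplus> spread (path_sum f) z" .
    qed
    moreover have "(\<lambda>z. g z \<oplus> d z) \<in> CI" using CI.a_closed[OF g(1) d] by simp
    ultimately show ?thesis by (intro bexI[of _ "\<lambda>z. g z \<oplus> d z"]) simp_all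
  qed
qed

lemma kernel_path_sum: "a_kernel PA Mat path_sum = CI"
proof
  show "a_kernel PA Mat path_sum \<subseteq> CI"
  proof
    fix f assume "f \<in> a_kernel PA Mat path_sum"
    then have f: "f \<in> carrier PA" "path_sum f = zero Mat"
      unfolding a_kernel_def' by blast+
    then obtain g where g: "g \<in> CI" "f = g \<oplus>\<^bsub>PA\<^esub> spread (path_sum f)"
      using equiv_spread_path_sum[OF _ f(1) order_refl] PA_carrier by blast
    have "spread (path_sum f) = zero PA" using f by (auto simp: spread_def)
    then have "f = g" using g ideal.Icarr[OF ideal_CI g(1)] PA.r_zero by metis
    then show "f \<in> CI" using g by simp
  qed
qed (rule CI_subset_kernel)

abbreviation CA where "CA \<equiv> commuting_algebra K Q"
abbreviation proj where "proj \<equiv> commuting_proj K Q"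

text \<open>
  The map induced by \<open>path_sum\<close> on the commuting algebra, where it is an isomorphism.
\<close>

definition coset_sum :: "(('v, 'e) qpath \<Rightarrow> 'a) set \<Rightarrow> 'v \<Rightarrow> 'v \<Rightarrow> 'a" where
  "coset_sum X = the_elem (path_sum ` X)"

lemma CA_simps [simp]:
  "carrier CA = carrier (PA Quot CI)" "mult CA = mult (PA Quot CI)" "one CA = one (PA Quot CI)"
  "zero CA = zero (PA Quot CI)" "add CA = add (PA Quot CI)"
  by (simp_all add: commuting_algebra_def quotient_algebra_def)

lemma CA_carrier: "carrier CA = proj ` carrier PA"
  by (auto simp: FactRing_def A_RCOSETS_def' commuting_proj_def)

lemma ring_CA: "ring CA"
proof -
  interpret q: ring "PA Quot CI" by (rule ideal.quotient_is_ring[OF ideal_CI])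
  show ?thesis
  proof (intro ringI abelian_groupI monoidI)
    fix X assume "X \<in> carrier CA"
    then show "\<exists>Y\<in>carrier CA. Y \<oplus>\<^bsub>CA\<^esub> X = \<zero>\<^bsub>CA\<^esub>"
      using q.a_inv_closed[of X] q.l_neg[of X] by (auto simp del: q.a_inv_closed)
  qed (simp_all add: q.a_assoc q.a_comm q.a_lcomm q.m_assoc q.l_distr q.r_distr)
qed

lemma coset_sum_proj: "f \<in> carrier PA \<Longrightarrow> coset_sum (proj f) = path_sum f"
  using path_sum.the_elem_simp unfolding coset_sum_def commuting_proj_def kernel_path_sum .

lemma coset_sum_iso: "coset_sum \<in> ring_iso CA Mat"
proof -
  have surj: "path_sum ` carrier PA = carrier Mat"
    using path_sum_closed path_sum_spread spread_closed by (blast intro: image_eqI[OF sym])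
  have "coset_sum \<in> ring_iso (PA Quot CI) Mat"
    using path_sum.FactRing_iso_set[OF surj] unfolding kernel_path_sum coset_sum_def .
  then show ?thesis by (simp add: ring_iso_def ring_hom_def del: structural_matrices_simps)
qed

text \<open>
  The scalar multiple of a coset is defined as a union over its elements. All of them give the same coset, because
  the ideal is closed under scalars.
\<close>

lemma CA_smult:
  assumes c: "c \<in> carrier K" and f: "f \<in> carrier PA"
  shows "c \<odot>\<^bsub>CA\<^esub> proj f = proj (\<lambda>x. c \<otimes> f x)"
proof -
  interpret CI: ideal CI PA by (rule ideal_CI)
  note cf = PA_smult_closed[OF c f]
  have "CI +>\<^bsub>PA\<^esub> (c \<odot>\<^bsub>PA\<^esub> x) = proj (\<lambda>x. c \<otimes> f x)" if "x \<in> proj f" for x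
  proof -
    from that obtain i where i: "i \<in> CI" "x = (\<lambda>z. i z \<oplus> f z)"
      by (auto simp: commuting_proj_def a_r_coset_def')
    have "(c \<odot>\<^bsub>PA\<^esub> x) = (\<lambda>z. c \<otimes> i z) \<oplus>\<^bsub>PA\<^esub> (\<lambda>z. c \<otimes> f z)"
      using i CI.Icarr[OF i(1)] c f by (auto simp: r_distr PA_coeff)
    moreover have "(\<lambda>z. c \<otimes> i z) \<in> CI" using CI_smult c i by simp
    ultimately have "(c \<odot>\<^bsub>PA\<^esub> x) \<in> CI +>\<^bsub>PA\<^esub> (\<lambda>z. c \<otimes> f z)"
      unfolding a_r_coset_def' by blast
    then show ?thesis
      unfolding commuting_proj_def using cf CI.a_repr_independence' by metis
  qed
  moreover have "f \<in> proj f" unfolding commuting_proj_def using f by (rule CI.a_rcos_self)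
  ultimately show ?thesis
    unfolding commuting_algebra_def quotient_algebra_def by auto
qed

lemma CA_smult_closed: "c \<in> carrier K \<Longrightarrow> X \<in> carrier CA \<Longrightarrow> c \<odot>\<^bsub>CA\<^esub> X \<in> carrier CA"
  unfolding CA_carrier using CA_smult PA_smult_closed by auto

lemma coset_sum_smult:
  "c \<in> carrier K \<Longrightarrow> X \<in> carrier CA \<Longrightarrow> coset_sum (c \<odot>\<^bsub>CA\<^esub> X) = c \<odot>\<^bsub>Mat\<^esub> coset_sum X"
  unfolding CA_carrier by (auto simp: CA_smult coset_sum_proj PA_smult_closed path_sum_smult)

theorem commuting_algebra_iso_matrices: "algebra_isomorphic K CA Mat"
  unfolding algebra_isomorphic_def using coset_sum_iso coset_sum_smult by blast

end

section \<open>Reachability in the quiver of a finite poset\<close>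

lemma fin_digraph_poset_quiver:
  assumes "finite S"
  shows "fin_digraph (poset_quiver S r)"
proof
  have "arcs (poset_quiver S r) \<subseteq> S \<times> S"
    by (auto simp: poset_quiver_def immediate_succ_def)
  then show "finite (arcs (poset_quiver S r))"
    using assms by (auto intro: finite_subset)
qed (use assms in \<open>auto simp: poset_quiver_def immediate_succ_def\<close>)

text \<open>
  Arcs of the quiver are strict relations, so walks stay inside the order. Conversely, a relation that is
  neither trivial nor an arc has an element strictly between; the intervals on either side of it are
  smaller, and induction on their size joins walks through them. Finiteness is essential here: a dense order
  has no immediate successors.
\<close>

lemma reach_poset_quiver:
  assumes S: "finite S" and r: "partial_order_on S r"
  shows "reach (poset_quiver S r) = r"
proof -
  let ?Q = "poset_quiver S r"
  interpret fin_digraph ?Q by (rule fin_digraph_poset_quiver[OF S])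
  have rS: "r \<subseteq> S \<times> S" and refl: "\<And>x. x \<in> S \<Longrightarrow> (x, x) \<in> r" and trans: "trans r" and anti: "antisym r"
    using r by (auto simp: partial_order_on_def preorder_on_def refl_on_def)
  have "(u, v) \<in> r" if "awalk u p v" for u p v
    using that
  proof (induction p arbitrary: u)
    case Nil
    then have "u = v" "u \<in> verts ?Q" using awalk_Nil_iff by blast+
    then show ?case using refl by (simp add: poset_quiver_def)
  next
    case (Cons a p)
    then have a: "a \<in> arcs ?Q" "u = tail ?Q a" "awalk (head ?Q a) p v"
      by (simp_all add: awalk_Cons_iff)
    have "(u, head ?Q a) \<in> r"
      using a(1,2) by (auto simp: poset_quiver_def immediate_succ_def)
    moreover have "(head ?Q a, v) \<in> r" using a(3) by (rule Cons.IH)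
    ultimately    show ?case by (rule transD[OF trans])
  qed
  moreover have "\<exists>p. awalk u p v" if "(u, v) \<in> r" for u v
    using that
  proof (induction "card {x. (u, x) \<in> r \<and> (x, v) \<in> r}" arbitrary: u v rule: less_induct)
    case less
    have uv: "u \<in> S" "v \<in> S" using less.prems rS by auto
    have fin: "finite {x. (a, x) \<in> r \<and> (x, b) \<in> r}" for a b
      by (rule finite_subset[OF _ S]) (use rS in auto)
    consider "u = v" | "immediate_succ S r u v"
      | x where "x \<in> S" "(u, x) \<in> r" "u \<noteq> x" "(x, v) \<in> r" "x \<noteq> v"
      using uv less.prems by (auto simp: immediate_succ_def)
    then show ?case
    proof cases
      case 1
      moreover have "u \<in> verts ?Q" using uv by (simp add: poset_quiver_def)
      ultimately show ?thesis using awalk_Nil_iff by blast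
    next
      case 2
      then show ?thesis using arc_implies_awalk[of "(u, v)"] by (auto simp: poset_quiver_def)
    next
      case 3
      have "(v, x) \<notin> r" "(x, u) \<notin> r" using 3 anti by (auto dest: antisymD)
      then have "{y. (u, y) \<in> r \<and> (y, x) \<in> r} \<subset> {y. (u, y) \<in> r \<and> (y, v) \<in> r}"
        "{y. (x, y) \<in> r \<and> (y, v) \<in> r} \<subset> {y. (u, y) \<in> r \<and> (y, v) \<in> r}"
        using 3 uv refl less.prems by (auto intro: transD[OF trans])
      then have "\<exists>p. awalk u p x" "\<exists>p. awalk x p v"
        using 3 fin by (auto intro!: less.hyps psubset_card_mono)
      then show ?thesis by (blast intro: awalk_appendI)
    qed
  qed
  ultimately show ?thesis by (auto simp: reach_def)
qed

section \<open>Endomorphisms of sums of corner modules\<close>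

text \<open>
  An algebra \<open>A\<close> is identified by \<open>\<Psi>\<close> with structural matrices, and each \<open>e i\<close> corresponds to the
  diagonal matrix unit at \<open>w i\<close>. The aim is to identify the endomorphisms of the sum of the right
  ideals \<open>e i A\<close> with the matrices that \<open>\<Psi>\<close> yields at the chosen indices. That scalars
  commute past products in \<open>A\<close> is read off from the matrices, as \<open>\<Psi>\<close> is injective.
\<close>

locale matrix_corners = K: cring K + A: ring A
  for K :: "('k, 'c) ring_scheme" and A :: "('k, 'a, 'd) module_scheme" (structure) +
  fixes S :: "'s set" and R :: "('s \<times> 's) set" and \<Psi> :: "'a \<Rightarrow> 's \<Rightarrow> 's \<Rightarrow> 'k"
    and I :: "'i set" and w :: "'i \<Rightarrow> 's" and e :: "'i \<Rightarrow> 'a"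
  assumes finite_S: "finite S" and finite_I: "finite I"
    and w_in_S: "i \<in> I \<Longrightarrow> w i \<in> S"
    and iso: "\<Psi> \<in> ring_iso A (structural_matrices K S R)"
    and smult_closed: "c \<in> carrier K \<Longrightarrow> a \<in> carrier A \<Longrightarrow> c \<odot> a \<in> carrier A"
    and smult: "c \<in> carrier K \<Longrightarrow> a \<in> carrier A \<Longrightarrow> \<Psi> (c \<odot> a) u v = c \<otimes>\<^bsub>K\<^esub> \<Psi> a u v"
    and e_closed: "i \<in> I \<Longrightarrow> e i \<in> carrier A"
    and \<Psi>_e: "i \<in> I \<Longrightarrow> \<Psi> (e i) u v = (if u = w i \<and> v = w i then \<one>\<^bsub>K\<^esub> else \<zero>\<^bsub>K\<^esub>)"
begin

abbreviation P where "P \<equiv> direct_sum I (\<lambda>i. principal_right_ideal A (e i))"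
abbreviation E where "E \<equiv> End_algebra A P"
abbreviation T where
  "T \<equiv> structural_matrices K I {(i, j). i \<in> I \<and> j \<in> I \<and> (w i, w j) \<in> R}"

lemma \<Psi>_closed: "a \<in> carrier A \<Longrightarrow> \<Psi> a u v \<in> carrier K"
  and \<Psi>_off: "a \<in> carrier A \<Longrightarrow> (u, v) \<notin> R \<Longrightarrow> \<Psi> a u v = \<zero>\<^bsub>K\<^esub>"
  using iso by (auto simp: ring_iso_def ring_hom_def Pi_def)

lemma \<Psi>_mult: "a \<in> carrier A \<Longrightarrow> b \<in> carrier A \<Longrightarrow>
    \<Psi> (a \<otimes> b) u v = (\<Oplus>\<^bsub>K\<^esub>s\<in>S. \<Psi> a u s \<otimes>\<^bsub>K\<^esub> \<Psi> b s v)"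
  and \<Psi>_add: "a \<in> carrier A \<Longrightarrow> b \<in> carrier A \<Longrightarrow> \<Psi> (a \<oplus> b) u v = \<Psi> a u v \<oplus>\<^bsub>K\<^esub> \<Psi> b u v"
  using iso by (auto simp: ring_iso_def ring_hom_def)

lemma \<Psi>_inject: "a \<in> carrier A \<Longrightarrow> b \<in> carrier A \<Longrightarrow> (\<And>u v. \<Psi> a u v = \<Psi> b u v) \<Longrightarrow> a = b"
proof -
  assume "a \<in> carrier A" "b \<in> carrier A" "\<And>u v. \<Psi> a u v = \<Psi> b u v"
  moreover from this have "\<Psi> a = \<Psi> b" by (intro ext) simp
  ultimately show "a = b" using iso by (auto simp: ring_iso_def bij_betw_def inj_on_def)
qed

lemma \<Psi>_surj:
  assumes "\<And>u v. m u v \<in> carrier K" "\<And>u v. (u, v) \<notin> R \<Longrightarrow> m u v = \<zero>\<^bsub>K\<^esub>"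
  shows "\<exists>a\<in>carrier A. \<Psi> a = m"
proof -
  have "m \<in> \<Psi> ` carrier A"
    using iso assms by (simp add: ring_iso_def bij_betw_def)
  then show ?thesis by blast
qed

lemma \<Psi>_zero: "\<Psi> \<zero> u v = \<zero>\<^bsub>K\<^esub>"
proof -
  have "\<Psi> \<zero> u v \<oplus>\<^bsub>K\<^esub> \<Psi> \<zero> u v = \<Psi> \<zero> u v"
    using \<Psi>_add[of \<zero> \<zero> u v] by simp
  then show ?thesis using \<Psi>_closed[of \<zero> u v] by (simp add: K.add.l_cancel_one)
qed

lemma \<Psi>_finsum:
  assumes "finite J" "f \<in> J \<rightarrow> carrier A"
  shows "\<Psi> (finsum A f J) u v = (\<Oplus>\<^bsub>K\<^esub>j\<in>J. \<Psi> (f j) u v)"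
  using assms
proof (induction J)
  case empty
  then show ?case by (simp add: \<Psi>_zero)
next
  case (insert j J)
  then show ?case by (auto simp: \<Psi>_add \<Psi>_closed Pi_def)
qed

lemma \<Psi>_e_mult:
  assumes i: "i \<in> I" and a: "a \<in> carrier A"
  shows "\<Psi> (e i \<otimes> a) u v = (if u = w i then \<Psi> a u v else \<zero>\<^bsub>K\<^esub>)"
proof -
  have "\<Psi> (e i \<otimes> a) u v = \<Psi> (e i) u (w i) \<otimes>\<^bsub>K\<^esub> \<Psi> a (w i) v"
    unfolding \<Psi>_mult[OF e_closed[OF i] a]
    by (rule K.finsum_only) (use i a in \<open>auto simp: w_in_S finite_S \<Psi>_e \<Psi>_closed\<close>)
  then show ?thesis using i a by (simp add: \<Psi>_e \<Psi>_closed)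
qed

lemma \<Psi>_mult_e:
  assumes i: "i \<in> I" and a: "a \<in> carrier A"
  shows "\<Psi> (a \<otimes> e i) u v = (if v = w i then \<Psi> a u v else \<zero>\<^bsub>K\<^esub>)"
proof -
  have "\<Psi> (a \<otimes> e i) u v = \<Psi> a u (w i) \<otimes>\<^bsub>K\<^esub> \<Psi> (e i) (w i) v"
    unfolding \<Psi>_mult[OF a e_closed[OF i]]
    by (rule K.finsum_only) (use i a in \<open>auto simp: w_in_S finite_S \<Psi>_e \<Psi>_closed\<close>)
  then show ?thesis using i a by (simp add: \<Psi>_e \<Psi>_closed)
qed

lemma e_idem: "i \<in> I \<Longrightarrow> e i \<otimes> e i = e i"
  by (rule \<Psi>_inject) (auto simp: \<Psi>_e_mult \<Psi>_e e_closed)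

text \<open>
  The scalars of the endomorphism algebra act by right multiplication with \<open>c \<cdot> 1\<close>; this makes sense because
  that element is central.
\<close>

lemma mult_scalar_one:
  assumes c: "c \<in> carrier K" and a: "a \<in> carrier A"
  shows "a \<otimes> (c \<odot> \<one>) = c \<odot> a" "(c \<odot> \<one>) \<otimes> a = c \<odot> a"
proof -
  note [simp] = \<Psi>_closed smult_closed smult \<Psi>_mult finite_S
  have "\<Psi> (a \<otimes> (c \<odot> \<one>)) u v = \<Psi> (c \<odot> (a \<otimes> \<one>)) u v" for u v
    using c a
    by (simp add: K.finsum_rdistr Pi_def K.m_lcomm cong: K.finsum_cong del: A.r_one)
  moreover have "\<Psi> ((c \<odot> \<one>) \<otimes> a) u v = \<Psi> (c \<odot> (\<one> \<otimes> a)) u v" for u v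
    using c a
    by (simp add: K.finsum_rdistr Pi_def K.m_assoc cong: K.finsum_cong del: A.l_one)
  ultimately show "a \<otimes> (c \<odot> \<one>) = c \<odot> a" "(c \<odot> \<one>) \<otimes> a = c \<odot> a"
    using c a by (auto intro!: \<Psi>_inject simp del: \<Psi>_mult)
qed

lemma P_carrier: "x \<in> carrier P \<longleftrightarrow>
    x \<in> extensional I \<and> (\<forall>i\<in>I. x i \<in> carrier A \<and> e i \<otimes> x i = x i)"
proof -
  have "b \<in> {e i \<otimes> a |a. a \<in> carrier A} \<longleftrightarrow> b \<in> carrier A \<and> e i \<otimes> b = b" if "i \<in> I" for i b
    using that e_closed[OF that] by (force simp: A.m_assoc[symmetric] e_idem)
  then show ?thesis
    using finite_I by (auto simp: direct_sum_def principal_right_ideal_def PiE_iff)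
qed

lemma P_simps [simp]:
  "zero P = (\<lambda>i\<in>I. \<zero>)" "add P x y = (\<lambda>i\<in>I. x i \<oplus> y i)" "ract P x a = (\<lambda>i\<in>I. x i \<otimes> a)"
  by (simp_all add: direct_sum_def principal_right_ideal_def cong: restrict_cong)

lemma P_add_closed: "x \<in> carrier P \<Longrightarrow> y \<in> carrier P \<Longrightarrow> add P x y \<in> carrier P"
  by (auto simp: P_carrier A.r_distr e_closed)

lemma P_ract_closed: "x \<in> carrier P \<Longrightarrow> a \<in> carrier A \<Longrightarrow> ract P x a \<in> carrier P"
  by (auto simp: P_carrier A.m_assoc[symmetric] e_closed)

lemma P_zero_closed: "zero P \<in> carrier P"
  by (auto simp: P_carrier e_closed)

lemma P_eqI: "x \<in> carrier P \<Longrightarrow> y \<in> carrier P \<Longrightarrow> (\<And>i. i \<in> I \<Longrightarrow> x i = y i) \<Longrightarrow> x = y"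
  by (auto simp: P_carrier intro: extensionalityI)

text \<open>
  The canonical generator of the summand \<open>e j A\<close>, seen in the direct sum.
\<close>

definition \<iota> :: "'i \<Rightarrow> 'i \<Rightarrow> 'a" where
  "\<iota> j = (\<lambda>i\<in>I. if i = j then e j else \<zero>)"

lemma \<iota>_closed: "j \<in> I \<Longrightarrow> \<iota> j \<in> carrier P"
  by (auto simp: P_carrier \<iota>_def e_closed e_idem)

lemma E_carrier: "\<phi> \<in> carrier E \<longleftrightarrow> \<phi> \<in> carrier P \<rightarrow>\<^sub>E carrier P \<and>
    (\<forall>x\<in>carrier P. \<forall>y\<in>carrier P. \<phi> (add P x y) = add P (\<phi> x) (\<phi> y)) \<and>
    (\<forall>x\<in>carrier P. \<forall>a\<in>carrier A. \<phi> (ract P x a) = ract P (\<phi> x) a)"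
  by (simp add: End_algebra_def)

lemma E_apply_closed: "\<phi> \<in> carrier E \<Longrightarrow> x \<in> carrier P \<Longrightarrow> \<phi> x \<in> carrier P"
  by (auto simp: E_carrier simp del: P_simps)

lemma E_apply_add: "\<phi> \<in> carrier E \<Longrightarrow> x \<in> carrier P \<Longrightarrow> y \<in> carrier P \<Longrightarrow>
    \<phi> (add P x y) = add P (\<phi> x) (\<phi> y)"
  by (auto simp: E_carrier simp del: P_simps)

lemma E_apply_ract: "\<phi> \<in> carrier E \<Longrightarrow> x \<in> carrier P \<Longrightarrow> a \<in> carrier A \<Longrightarrow>
    \<phi> (ract P x a) = ract P (\<phi> x) a"
  by (auto simp: E_carrier simp del: P_simps)

lemma E_simps [simp]:
  "mult E = compose (carrier P)" "one E = (\<lambda>x\<in>carrier P. x)"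
  "add E = (\<lambda>\<phi> \<psi>. \<lambda>x\<in>carrier P. add P (\<phi> x) (\<psi> x))"
  "smult E = (\<lambda>c \<phi>. \<lambda>x\<in>carrier P. ract P (\<phi> x) (c \<odot> \<one>))"
  by (simp_all add: End_algebra_def)

lemma E_one_closed: "one E \<in> carrier E"
  by (auto simp: E_carrier P_add_closed P_ract_closed simp del: P_simps)

lemma E_mult_closed: "\<phi> \<in> carrier E \<Longrightarrow> \<psi> \<in> carrier E \<Longrightarrow> mult E \<phi> \<psi> \<in> carrier E"
  unfolding E_carrier[of "mult E \<phi> \<psi>"]
  by (auto simp: compose_eq compose_def E_apply_closed E_apply_add E_apply_ract
      P_add_closed P_ract_closed simp del: P_simps)

lemma E_add_closed:
  assumes \<phi>: "\<phi> \<in> carrier E" and \<psi>: "\<psi> \<in> carrier E"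
  shows "add E \<phi> \<psi> \<in> carrier E"
proof -
  have "add P (add P x y) (add P x' y') = add P (add P x x') (add P y y')"
    if "x \<in> carrier P" "y \<in> carrier P" "x' \<in> carrier P" "y' \<in> carrier P" for x y x' y'
    using that by (auto simp: P_carrier A.a_ac intro!: restrict_ext)
  moreover have "ract P (add P x y) a = add P (ract P x a) (ract P y a)"
    if "x \<in> carrier P" "y \<in> carrier P" "a \<in> carrier A" for x y a
    using that by (auto simp: P_carrier A.l_distr intro!: restrict_ext)
  ultimately show ?thesis
    unfolding E_carrier[of "add E \<phi> \<psi>"] using \<phi> \<psi>
    by (auto simp: E_apply_closed E_apply_add E_apply_ract P_add_closed P_ract_closed simp del: P_simps)
qed

lemma E_smult_closed:
  assumes c: "c \<in> carrier K" and \<phi>: "\<phi> \<in> carrier E"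
  shows "smult E c \<phi> \<in> carrier E"
proof -
  have c1: "c \<odot> \<one> \<in> carrier A" using c by (simp add: smult_closed)
  have "ract P (add P x y) (c \<odot> \<one>) = add P (ract P x (c \<odot> \<one>)) (ract P y (c \<odot> \<one>))"
    if "x \<in> carrier P" "y \<in> carrier P" for x y
    using that c1 by (auto simp: P_carrier A.l_distr intro!: restrict_ext)
  moreover have "ract P (ract P x a) (c \<odot> \<one>) = ract P (ract P x (c \<odot> \<one>)) a"
    if "x \<in> carrier P" "a \<in> carrier A" for x a
    using that c1 mult_scalar_one[OF c that(2)]
    by (auto simp: P_carrier A.m_assoc intro!: restrict_ext)
  ultimately show ?thesis
    unfolding E_carrier[of "smult E c \<phi>"] using \<phi> c1
    by (auto simp: E_apply_closed E_apply_add E_apply_ract P_add_closed P_ract_closed simp del: P_simps)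
qed

abbreviation entry :: "(('i \<Rightarrow> 'a) \<Rightarrow> 'i \<Rightarrow> 'a) \<Rightarrow> 'i \<Rightarrow> 'i \<Rightarrow> 'a" where
  "entry \<phi> i j \<equiv> \<phi> (\<iota> j) i"

lemma entry_closed:
  assumes "\<phi> \<in> carrier E" "i \<in> I" "j \<in> I"
  shows "entry \<phi> i j \<in> carrier A" "e i \<otimes> entry \<phi> i j = entry \<phi> i j"
  using E_apply_closed[OF assms(1) \<iota>_closed[OF assms(3)]] assms(2) by (auto simp: P_carrier)

lemma entry_mult_e:
  assumes "\<phi> \<in> carrier E" "i \<in> I" "j \<in> I"
  shows "entry \<phi> i j \<otimes> e j = entry \<phi> i j"
proof -
  have "ract P (\<iota> j) (e j) = \<iota> j"
    using assms(3) by (auto simp: \<iota>_def e_idem e_closed intro!: restrict_ext)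
  then have "\<phi> (\<iota> j) = ract P (\<phi> (\<iota> j)) (e j)"
    using E_apply_ract[OF assms(1) \<iota>_closed[OF assms(3)] e_closed[OF assms(3)]] by simp
  from fun_cong[OF this, of i] show ?thesis using assms(2) by simp
qed

text \<open>
  The entry in position \<open>i, j\<close> lies in the corner \<open>e i A e j\<close>, which under \<open>\<Psi>\<close> consists of the matrices
  supported at the single place \<open>(w i, w j)\<close>; one scalar determines it.
\<close>

lemma \<Psi>_entry:
  assumes "\<phi> \<in> carrier E" "i \<in> I" "j \<in> I"
  shows "\<Psi> (entry \<phi> i j) u v
    = (if u = w i \<and> v = w j then \<Psi> (entry \<phi> i j) (w i) (w j) else \<zero>\<^bsub>K\<^esub>)"
  using \<Psi>_e_mult[OF assms(2) entry_closed(1)[OF assms], of u v]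
    \<Psi>_mult_e[OF assms(3) entry_closed(1)[OF assms], of u v]
  by (auto simp: entry_closed(2)[OF assms] entry_mult_e[OF assms])

lemma E_apply_zero: "\<phi> \<in> carrier E \<Longrightarrow> \<phi> (zero P) = zero P"
proof -
  assume \<phi>: "\<phi> \<in> carrier E"
  have "ract P (zero P) \<zero> = zero P" by (auto intro!: restrict_ext)
  then have "\<phi> (zero P) = ract P (\<phi> (zero P)) \<zero>"
    using E_apply_ract[OF \<phi> P_zero_closed, of \<zero>] by simp
  moreover have "ract P (\<phi> (zero P)) \<zero> = zero P"
    using E_apply_closed[OF \<phi> P_zero_closed] by (auto simp: P_carrier intro!: restrict_ext)
  ultimately show ?thesis by simp
qed

text \<open>
  Since \<open>x\<close> is the sum of the \<open>\<iota> j \<cdot> x j\<close>, an endomorphism acts by left multiplication with the matrix of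
  its entries. The proof adds the components of \<open>x\<close> one index at a time.
\<close>

lemma E_apply_eq:
  assumes \<phi>: "\<phi> \<in> carrier E" and x: "x \<in> carrier P" and i: "i \<in> I"
  shows "\<phi> x i = (\<Oplus>j\<in>I. entry \<phi> i j \<otimes> x j)"
proof -
  \<comment> \<open>the truncations of \<open>x\<close> to subsets of \<open>I\<close>, which drive the induction\<close>
  define cut where "cut J = (\<lambda>i\<in>I. if i \<in> J then x i else \<zero>)" for J
  have cut_closed: "cut J \<in> carrier P" for J
    using x by (auto simp: P_carrier cut_def e_closed)
  have "\<phi> (cut J) i = (\<Oplus>j\<in>J. entry \<phi> i j \<otimes> x j)" if "finite J" "J \<subseteq> I" for J
    using that
  proof (induction J)
    case empty
    have "cut {} = zero P" by (auto simp: cut_def)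
    then have "\<phi> (cut {}) = zero P" by (simp only: E_apply_zero[OF \<phi>])
    then show ?case using i by simp
  next
    case (insert j J)
    then have j: "j \<in> I" and xj: "x j \<in> carrier A" "e j \<otimes> x j = x j" using x by (auto simp: P_carrier)
    have cl: "ract P (\<iota> j) (x j) \<in> carrier P" using P_ract_closed[OF \<iota>_closed[OF j] xj(1)] .
    have "cut (insert j J) = add P (cut J) (ract P (\<iota> j) (x j))"
      using insert.hyps xj x by (auto simp: cut_def \<iota>_def P_carrier intro!: restrict_ext)
    then have "\<phi> (cut (insert j J)) = add P (\<phi> (cut J)) (ract P (\<phi> (\<iota> j)) (x j))"
      using E_apply_add[OF \<phi> cut_closed cl] E_apply_ract[OF \<phi> \<iota>_closed[OF j] xj(1)] by simp
    then have "\<phi> (cut (insert j J)) i = (\<Oplus>j\<in>J. entry \<phi> i j \<otimes> x j) \<oplus> entry \<phi> i j \<otimes> x j"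
      using i insert by simp
    moreover have "(\<lambda>j. entry \<phi> i j \<otimes> x j) \<in> insert j J \<rightarrow> carrier A"
      using entry_closed(1)[OF \<phi> i] x insert.prems by (auto simp: P_carrier)
    ultimately show ?case
      using insert.hyps by (auto simp: A.a_comm)
  qed
  moreover have "cut I = x"
    by (rule P_eqI[OF cut_closed x]) (simp add: cut_def)
  ultimately show ?thesis using finite_I by force
qed

definition entries :: "(('i \<Rightarrow> 'a) \<Rightarrow> 'i \<Rightarrow> 'a) \<Rightarrow> 'i \<Rightarrow> 'i \<Rightarrow> 'k" where
  "entries \<phi> i j = (if i \<in> I \<and> j \<in> I then \<Psi> (entry \<phi> i j) (w i) (w j) else \<zero>\<^bsub>K\<^esub>)"

lemma entries_closed: "\<phi> \<in> carrier E \<Longrightarrow> entries \<phi> \<in> carrier T"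
  by (auto simp: entries_def entry_closed \<Psi>_closed \<Psi>_off)

text \<open>
  Endomorphisms act on the left of column vectors, so composition of functions is the product of matrices in the same
  order: the skeleton is the incidence algebra itself and not its opposite.
\<close>

lemma entries_mult:
  assumes \<phi>: "\<phi> \<in> carrier E" and \<psi>: "\<psi> \<in> carrier E"
  shows "entries (mult E \<phi> \<psi>) = mult T (entries \<phi>) (entries \<psi>)"
proof (intro ext)
  fix i k
  show "entries (mult E \<phi> \<psi>) i k = mult T (entries \<phi>) (entries \<psi>) i k"
  proof (cases "i \<in> I \<and> k \<in> I")
    case False
    have "mult T (entries \<phi>) (entries \<psi>) i k = (\<Oplus>\<^bsub>K\<^esub>j\<in>I. \<zero>\<^bsub>K\<^esub>)"
      unfolding structural_matrices_simps
      by (rule K.add.finprod_cong')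
        (use False in \<open>auto simp: entries_def entry_closed[OF \<phi>] entry_closed[OF \<psi>] \<Psi>_closed\<close>)
    then show ?thesis using False by (auto simp: entries_def)
  next
    case True
    then have i: "i \<in> I" and k: "k \<in> I" by auto
    note cl = entry_closed(1)[OF \<phi> i] entry_closed(1)[OF \<psi> _ k]
    have "entry (mult E \<phi> \<psi>) i k = (\<Oplus>j\<in>I. entry \<phi> i j \<otimes> entry \<psi> j k)"
      using E_apply_eq[OF \<phi> E_apply_closed[OF \<psi> \<iota>_closed[OF k]] i] \<iota>_closed[OF k]
      by (simp add: compose_eq)
    then have "entries (mult E \<phi> \<psi>) i k
        = (\<Oplus>\<^bsub>K\<^esub>j\<in>I. \<Psi> (entry \<phi> i j \<otimes> entry \<psi> j k) (w i) (w k))"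
      using True cl by (simp add: entries_def \<Psi>_finsum finite_I Pi_def)
    also have "\<dots> = (\<Oplus>\<^bsub>K\<^esub>j\<in>I. entries \<phi> i j \<otimes>\<^bsub>K\<^esub> entries \<psi> j k)"
    proof (rule K.add.finprod_cong')
      fix j assume j: "j \<in> I"
      have "\<Psi> (entry \<phi> i j \<otimes> entry \<psi> j k) (w i) (w k)
          = \<Psi> (entry \<phi> i j) (w i) (w j) \<otimes>\<^bsub>K\<^esub> \<Psi> (entry \<psi> j k) (w j) (w k)"
        unfolding \<Psi>_mult[OF cl(1)[OF j] cl(2)[OF j]]
      proof (rule K.finsum_only)
        fix s assume "s \<noteq> w j"
        then have "\<Psi> (entry \<phi> i j) (w i) s = \<zero>\<^bsub>K\<^esub>" using \<Psi>_entry[OF \<phi> i j, of "w i" s] by simp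
        then show "\<Psi> (entry \<phi> i j) (w i) s \<otimes>\<^bsub>K\<^esub> \<Psi> (entry \<psi> j k) s (w k) = \<zero>\<^bsub>K\<^esub>"
          using \<Psi>_closed[OF cl(2)[OF j]] by simp
      qed (use j cl in \<open>auto simp: w_in_S finite_S \<Psi>_closed\<close>)
      then show "\<Psi> (entry \<phi> i j \<otimes> entry \<psi> j k) (w i) (w k)
          = entries \<phi> i j \<otimes>\<^bsub>K\<^esub> entries \<psi> j k"
        using i j k by (simp add: entries_def)
    qed (use i k cl in \<open>auto simp: entries_def \<Psi>_closed\<close>)
    finally show ?thesis by simp
  qed
qed

lemma entries_add:
  assumes \<phi>: "\<phi> \<in> carrier E" and \<psi>: "\<psi> \<in> carrier E"
  shows "entries (add E \<phi> \<psi>) = add T (entries \<phi>) (entries \<psi>)"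
  using entry_closed(1)[OF \<phi>] entry_closed(1)[OF \<psi>]
  by (intro ext) (auto simp: entries_def \<iota>_closed \<Psi>_add)

lemma entries_smult:
  assumes c: "c \<in> carrier K" and \<phi>: "\<phi> \<in> carrier E"
  shows "entries (smult E c \<phi>) = smult T c (entries \<phi>)"
  using entry_closed(1)[OF \<phi>] c
  by (intro ext) (auto simp: entries_def \<iota>_closed mult_scalar_one smult)

lemma entries_one: "entries (one E) = one T"
  by (intro ext) (auto simp: entries_def \<iota>_closed, auto simp: \<iota>_def \<Psi>_e \<Psi>_zero)

lemma inj_entries: "inj_on entries (carrier E)"
proof (rule inj_onI)
  fix \<phi> \<psi> assume \<phi>: "\<phi> \<in> carrier E" and \<psi>: "\<psi> \<in> carrier E" and eq: "entries \<phi> = entries \<psi>"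
  have ent: "entry \<phi> i j = entry \<psi> i j" if i: "i \<in> I" and j: "j \<in> I" for i j
  proof (rule \<Psi>_inject)
    fix u v
    have "\<Psi> (entry \<phi> i j) (w i) (w j) = \<Psi> (entry \<psi> i j) (w i) (w j)"
      using fun_cong[OF fun_cong[OF eq, of i], of j] i j by (simp add: entries_def)
    then show "\<Psi> (entry \<phi> i j) u v = \<Psi> (entry \<psi> i j) u v"
      using \<Psi>_entry[OF \<phi> i j, of u v] \<Psi>_entry[OF \<psi> i j, of u v] by metis
  qed (use i j \<phi> \<psi> entry_closed in auto)
  have "\<phi> x = \<psi> x" if x: "x \<in> carrier P" for x
  proof (rule P_eqI)
    fix i assume i: "i \<in> I"
    have "(\<Oplus>j\<in>I. entry \<phi> i j \<otimes> x j) = (\<Oplus>j\<in>I. entry \<psi> i j \<otimes> x j)"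
      using x i entry_closed(1)[OF \<psi>]
      by (intro A.add.finprod_cong') (auto simp: ent P_carrier)
    then show "\<phi> x i = \<psi> x i" using E_apply_eq[OF \<phi> x i] E_apply_eq[OF \<psi> x i] by simp
  qed (use x \<phi> \<psi> E_apply_closed in auto)
  moreover have "\<phi> \<in> extensional (carrier P)" "\<psi> \<in> extensional (carrier P)"
    using \<phi> \<psi> by (auto simp: E_carrier PiE_iff simp del: P_simps)
  ultimately show "\<phi> = \<psi>" by (rule extensionalityI[rotated 2])
qed

text \<open>
  Each entry of \<open>m\<close> is lifted to the corner \<open>e i A e j\<close>, which is possible because \<open>m i j\<close> can be
  nonzero only if \<open>(w i, w j)\<close> lies in \<open>R\<close>; the matrix of these lifts acts by left multiplication.
\<close>

lemma entries_surj:
  assumes m: "m \<in> carrier T"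
  shows "\<exists>\<phi>\<in>carrier E. entries \<phi> = m"
proof -
  have "\<exists>a\<in>carrier A. \<Psi> a = (\<lambda>u v. if u = w i \<and> v = w j then m i j else \<zero>\<^bsub>K\<^esub>)" for i j
    using m by (intro \<Psi>_surj) auto
  then obtain a where a: "\<And>i j. a i j \<in> carrier A"
    and \<Psi>_a: "\<And>i j. \<Psi> (a i j) = (\<lambda>u v. if u = w i \<and> v = w j then m i j else \<zero>\<^bsub>K\<^esub>)"
    by metis
  have e_a: "e i \<otimes> a i j = a i j" and a_e: "a i j \<otimes> e j = a i j" if "i \<in> I" "j \<in> I" for i j
    using that a e_closed by (auto intro!: \<Psi>_inject simp: \<Psi>_e_mult \<Psi>_mult_e \<Psi>_a)
  define \<phi> where "\<phi> = (\<lambda>x\<in>carrier P. \<lambda>i\<in>I. \<Oplus>j\<in>I. a i j \<otimes> x j)"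
  have ax: "(\<lambda>j. a i j \<otimes> x j) \<in> I \<rightarrow> carrier A" if "x \<in> carrier P" for x i
    using that a by (auto simp: P_carrier)
  have into: "\<phi> x \<in> carrier P" if x: "x \<in> carrier P" for x
  proof -
    have "e i \<otimes> (\<Oplus>j\<in>I. a i j \<otimes> x j) = (\<Oplus>j\<in>I. a i j \<otimes> x j)" if i: "i \<in> I" for i
    proof -
      have "e i \<otimes> (\<Oplus>j\<in>I. a i j \<otimes> x j) = (\<Oplus>j\<in>I. e i \<otimes> (a i j \<otimes> x j))"
        using finite_I e_closed[OF i] ax[OF x] by (rule A.finsum_rdistr)
      also have "\<dots> = (\<Oplus>j\<in>I. a i j \<otimes> x j)"
        using ax[OF x, of i] x a e_closed[OF i] i
        by (intro A.add.finprod_cong') (auto simp: A.m_assoc[symmetric] e_a P_carrier)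
      finally show ?thesis .
    qed
    then show ?thesis using x ax[OF x] by (auto simp: P_carrier \<phi>_def)
  qed
  have "\<phi> (add P x y) = add P (\<phi> x) (\<phi> y)" if x: "x \<in> carrier P" and y: "y \<in> carrier P" for x y
  proof (rule P_eqI)
    fix i assume i: "i \<in> I"
    have "(\<Oplus>j\<in>I. a i j \<otimes> add P x y j) = (\<Oplus>j\<in>I. a i j \<otimes> x j \<oplus> a i j \<otimes> y j)"
      using x y a ax[OF x, of i] ax[OF y, of i]
      by (intro A.add.finprod_cong') (auto simp: P_carrier A.r_distr)
    then show "\<phi> (add P x y) i = add P (\<phi> x) (\<phi> y) i"
      using i x y ax P_add_closed[OF x y] by (simp add: \<phi>_def A.finsum_addf)
  qed (use x y into P_add_closed in \<open>auto simp del: P_simps\<close>)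
  moreover have "\<phi> (ract P x b) = ract P (\<phi> x) b" if x: "x \<in> carrier P" and b: "b \<in> carrier A" for x b
  proof (rule P_eqI)
    fix i assume i: "i \<in> I"
    have "(\<Oplus>j\<in>I. a i j \<otimes> ract P x b j) = (\<Oplus>j\<in>I. a i j \<otimes> x j \<otimes> b)"
      using x b a ax[OF x, of i]
      by (intro A.add.finprod_cong') (auto simp: P_carrier A.m_assoc)
    also have "\<dots> = (\<Oplus>j\<in>I. a i j \<otimes> x j) \<otimes> b"
      using finite_I b ax[OF x] by (rule A.finsum_ldistr[symmetric])
    finally show "\<phi> (ract P x b) i = ract P (\<phi> x) b i"
      using i x P_ract_closed[OF x b] by (simp add: \<phi>_def)
  qed (use x b into P_ract_closed in \<open>auto simp del: P_simps\<close>)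
  ultimately have \<phi>: "\<phi> \<in> carrier E"
    using into by (auto simp: E_carrier \<phi>_def simp del: P_simps)
  have "entry \<phi> i j = a i j" if i: "i \<in> I" and j: "j \<in> I" for i j
  proof -
    have "(\<Oplus>k\<in>I. a i k \<otimes> \<iota> j k) = a i j \<otimes> \<iota> j j"
      by (rule A.finsum_only) (use i j a e_closed finite_I in \<open>auto simp: \<iota>_def\<close>)
    then show ?thesis using i j \<iota>_closed[OF j] by (simp add: \<phi>_def a_e \<iota>_def)
  qed
  then have "entries \<phi> = m"
    using m by (intro ext) (auto simp: entries_def \<Psi>_a)
  then show ?thesis using \<phi> by blast
qed

lemma entries_iso: "entries \<in> ring_iso E T"
proof -
  have "entries \<in> ring_hom E T"
    by (rule ring_hom_memI) (simp_all only: entries_closed entries_mult entries_add entries_one)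
  moreover have "bij_betw entries (carrier E) (carrier T)"
    unfolding bij_betw_def using inj_entries entries_closed entries_surj by blast
  ultimately show ?thesis by (simp add: ring_iso_def)
qed

theorem End_iso_matrices: "algebra_isomorphic K E T"
  unfolding algebra_isomorphic_def using entries_iso entries_smult by blast

end

section \<open>Incidence algebra and skeleton\<close>

text \<open>
  The composite of the first isomorphism with the inverse of the second respects the operations because the
  second is injective on \<open>B\<close>, where the results of the operations lie.
\<close>

lemma algebra_isomorphic_common_target:
  assumes "algebra_isomorphic K A T" "algebra_isomorphic K B T"
    and "\<one>\<^bsub>B\<^esub> \<in> carrier B"
    and mult: "\<And>x y. x \<in> carrier B \<Longrightarrow> y \<in> carrier B \<Longrightarrow> x \<otimes>\<^bsub>B\<^esub> y \<in> carrier B"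
    and add: "\<And>x y. x \<in> carrier B \<Longrightarrow> y \<in> carrier B \<Longrightarrow> x \<oplus>\<^bsub>B\<^esub> y \<in> carrier B"
    and smult: "\<And>c x. c \<in> carrier K \<Longrightarrow> x \<in> carrier B \<Longrightarrow> c \<odot>\<^bsub>B\<^esub> x \<in> carrier B"
  shows "algebra_isomorphic K A B"
proof -
  obtain h where h: "h \<in> ring_hom A T" "bij_betw h (carrier A) (carrier T)"
      "\<And>c x. c \<in> carrier K \<Longrightarrow> x \<in> carrier A \<Longrightarrow> h (c \<odot>\<^bsub>A\<^esub> x) = c \<odot>\<^bsub>T\<^esub> h x"
    using assms(1) by (auto simp: algebra_isomorphic_def ring_iso_def)
  obtain g where g: "g \<in> ring_hom B T" "bij_betw g (carrier B) (carrier T)"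
      "\<And>c x. c \<in> carrier K \<Longrightarrow> x \<in> carrier B \<Longrightarrow> g (c \<odot>\<^bsub>B\<^esub> x) = c \<odot>\<^bsub>T\<^esub> g x"
    using assms(2) by (auto simp: algebra_isomorphic_def ring_iso_def)
  define f where "f x = inv_into (carrier B) g (h x)" for x
  have f_cl: "f x \<in> carrier B" and gf: "g (f x) = h x" if "x \<in> carrier A" for x
    using that h(2) g(2) by (auto simp: f_def bij_betw_def intro!: inv_into_into f_inv_into_f)
  have f_eqI: "f x = y" if "h x = g y" "y \<in> carrier B" for x y
    using that g(2) by (simp add: f_def bij_betw_def)
  have "f \<in> ring_hom A B"
  proof (rule ring_hom_memI)
    fix x y assume "x \<in> carrier A" "y \<in> carrier A"
    then show "f (x \<otimes>\<^bsub>A\<^esub> y) = f x \<otimes>\<^bsub>B\<^esub> f y" "f (x \<oplus>\<^bsub>A\<^esub> y) = f x \<oplus>\<^bsub>B\<^esub> f y"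
      by (auto intro!: f_eqI simp: gf f_cl mult add ring_hom_mult[OF h(1)] ring_hom_mult[OF g(1)]
          ring_hom_add[OF h(1)] ring_hom_add[OF g(1)])
  qed (auto intro!: f_eqI simp: assms(3) f_cl ring_hom_one[OF h(1)] ring_hom_one[OF g(1)])
  moreover have "bij_betw f (carrier A) (carrier B)"
    using bij_betw_trans[OF h(2) bij_betw_inv_into[OF g(2)]] unfolding f_def comp_def .
  moreover have "f (c \<odot>\<^bsub>A\<^esub> x) = c \<odot>\<^bsub>B\<^esub> f x" if "c \<in> carrier K" "x \<in> carrier A" for c x
    using that by (intro f_eqI) (simp_all add: h(3) g(3) gf f_cl smult)
  ultimately show ?thesis by (auto simp: algebra_isomorphic_def ring_iso_def)
qed

theorem theorem6p5:
  fixes K :: "('k, 'c) ring_scheme"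
    and Q :: "('v, 'e) pre_digraph"
    and w :: "'v set \<Rightarrow> 'v"
  assumes "field K"
    and "fin_digraph Q"
    and "\<And>D. D \<in> path_components Q \<Longrightarrow> w D \<in> D"
  shows "algebra_isomorphic K (Incid K (skeleton_verts Q) (skeleton_order Q w)) (skeleton K Q w)"
proof -
  interpret K: field K by fact
  interpret Q: fin_digraph Q by fact
  interpret qa: quiver_algebra K Q by unfold_locales
  let ?V = "path_components Q" and ?r = "skeleton_order Q w"
  note equiv = equiv_path_equiv[OF Q.wf_digraph_axioms]
  have finV: "finite ?V"
    unfolding path_components_def
    by (rule finite_quotient) (use equiv Q.finite_verts in \<open>auto simp: path_equiv_def\<close>)
  have w: "w D \<in> verts Q" if "D \<in> ?V" for D
    using assms(3)[OF that] that in_quotient_imp_subset[OF equiv] unfolding path_components_def by blast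
  have order: "partial_order_on ?V ?r"
    using partial_order_skeleton[OF Q.wf_digraph_axioms assms(3)] by (simp add: skeleton_verts_def)
  have r: "?r = {(D, E). D \<in> ?V \<and> E \<in> ?V \<and> (w D, w E) \<in> reach Q}"
    by (simp add: skeleton_order_def skeleton_verts_def reach_def)
  interpret iq: quiver_algebra K "poset_quiver ?V ?r"
    using fin_digraph_poset_quiver[OF finV] K.is_cring by (simp add: quiver_algebra_def)
  have "algebra_isomorphic K (Incid K ?V ?r) (structural_matrices K ?V ?r)"
    using iq.commuting_algebra_iso_matrices reach_poset_quiver[OF finV order]
    by (simp add: Incid_def poset_quiver_def)
  moreover interpret sk: matrix_corners K "commuting_algebra K Q" "verts Q" "reach Q" qa.coset_sum
    ?V w "\<lambda>D. qa.proj (path_elt K (vertex_path (w D)))"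
  proof (intro matrix_corners.intro matrix_corners_axioms.intro)
    fix D u v assume D: "D \<in> ?V"
    have p: "vertex_path (w D) \<in> paths Q" using w[OF D] by (rule qa.vertex_path_in_paths)
    show "qa.proj (path_elt K (vertex_path (w D))) \<in> carrier qa.CA"
      unfolding qa.CA_carrier using qa.path_elt_closed[OF p] by blast
    show "qa.coset_sum (qa.proj (path_elt K (vertex_path (w D)))) u v
        = (if u = w D \<and> v = w D then \<one>\<^bsub>K\<^esub> else \<zero>\<^bsub>K\<^esub>)"
      using qa.coset_sum_proj[OF qa.path_elt_closed[OF p]] qa.path_sum_elt[OF p] by simp
  qed (use finV w qa.ring_CA qa.coset_sum_iso qa.CA_smult_closed qa.coset_sum_smult K.is_cring
      in \<open>simp_all\<close>)
  have "algebra_isomorphic K (skeleton K Q w) (structural_matrices K ?V ?r)"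
    using sk.End_iso_matrices unfolding skeleton_def r .
  ultimately show ?thesis
    unfolding skeleton_verts_def
    by (rule algebra_isomorphic_common_target; unfold skeleton_def;
        intro sk.E_one_closed sk.E_mult_closed sk.E_add_closed sk.E_smult_closed)
qed

end
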